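(* Let $\mathcal{F}$ be a family of locally univalent holomorphic functions on the unit disk $\mathbb{D}$, let $k\ge 2$ be an integer, and let $b$ be a meromorphic function on $\mathbb{D}$ such that every $f\in\mathcal{F}$ satisfies $$S_k(f)(z)\neq b(z)\qquad\text{for all } z\in\mathbb{D},$$ where $S_k(f)$ is the generalized Schwarzian derivative of order $k$. Then $\{f''/f' : f\in\mathcal{F}\}$ is a normal family on $\mathbb{D}$.
   Context: $\mathbb{D}=\{z\in\mathbb{C}:|z|<1\}$. For a non-constant meromorphic function $f$ on $\mathbb{D}$ and $n\in\mathbb{N}=\{1,2,3,\dots\}$, put $S_{2,n}(f):=f''/f'$ and, for $k\ge 2$, $S_{k+1,n}(f):=\big(S_{k,n}(f)\big)'-\frac1n\frac{f''}{f'}\,S_{k,n}(f)$. For $k\in\mathbb{N}$ the generalized Schwarzian derivative of order $k$ is $S_k(f):=S_{k+1,k}(f)$ ($S_2(f)$ is the classical Schwarzian). Normality is with respect to locally uniform convergence in the spherical metric, the limit $\equiv\infty$ being allowed. Locally univalent means locally injective, i.e. $f'$ has no zeros. *)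

theory Defs
  imports "HOL-Complex_Analysis.Complex_Analysis"
begin

subsection \<open>Schwarzian derivatives\<close>

definition pre_schwarzian :: "(complex \<Rightarrow> complex) \<Rightarrow> complex \<Rightarrow> complex" where
  "pre_schwarzian f z = deriv (deriv f) z / deriv f z"

text \<open>
  \<open>schwarzian_iter k n f\<close> is $S_{k,n}(f)$, which is meaningful for $k \geq 2$ only; the first two
  equations are dummies. For meromorphic \<open>f\<close> the defining formulas are evaluated pointwise, so that
  their values are the intended ones off the poles of \<open>f\<close> and the zeros of its derivative.
\<close>

fun schwarzian_iter :: "nat \<Rightarrow> nat \<Rightarrow> (complex \<Rightarrow> complex) \<Rightarrow> complex \<Rightarrow> complex" where
  "schwarzian_iter 0 n f = (\<lambda>z. 0)"
| "schwarzian_iter (Suc 0) n f = (\<lambda>z. 0)"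
| "schwarzian_iter (Suc (Suc 0)) n f = pre_schwarzian f"
| "schwarzian_iter (Suc (Suc (Suc k))) n f =
     (\<lambda>z. deriv (schwarzian_iter (Suc (Suc k)) n f) z
          - 1 / of_nat n * pre_schwarzian f z * schwarzian_iter (Suc (Suc k)) n f z)"

definition gen_schwarzian :: "nat \<Rightarrow> (complex \<Rightarrow> complex) \<Rightarrow> complex \<Rightarrow> complex" where
  "gen_schwarzian k f = schwarzian_iter (k + 1) k f"

definition locally_univalent_on :: "(complex \<Rightarrow> complex) \<Rightarrow> complex set \<Rightarrow> bool" where
  "locally_univalent_on f D \<longleftrightarrow> (\<forall>z\<in>D. \<exists>U. open U \<and> z \<in> U \<and> inj_on f (U \<inter> D))"

subsection \<open>The Riemann sphere and normal families\<close>

text \<open>\<^const>\<open>None\<close> plays the role of the point at infinity.\<close>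

type_synonym riemann_sphere = "complex option"

fun stereographic :: "riemann_sphere \<Rightarrow> complex \<times> real" where
  "stereographic None = (0, 1)"
| "stereographic (Some z) =
     (2 * z / of_real (1 + (cmod z)\<^sup>2), ((cmod z)\<^sup>2 - 1) / (1 + (cmod z)\<^sup>2))"

text \<open>Great-circle distance on the unit sphere.\<close>

definition spherical_dist :: "riemann_sphere \<Rightarrow> riemann_sphere \<Rightarrow> real" where
  "spherical_dist p q = arccos (stereographic p \<bullet> stereographic q)"

text \<open>
  The predicate \<^const>\<open>meromorphic_on\<close> leaves the values at isolated points arbitrary; the value of
  a meromorphic function as a map into the sphere is therefore the limit at the point.
\<close>

definition sphere_val :: "(complex \<Rightarrow> complex) \<Rightarrow> complex \<Rightarrow> riemann_sphere" where
  "sphere_val f z = (if is_pole f z then None else Some (remove_sings f z))"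

definition spherically_locally_uniform_limit ::
    "complex set \<Rightarrow> (nat \<Rightarrow> complex \<Rightarrow> riemann_sphere) \<Rightarrow> (complex \<Rightarrow> riemann_sphere) \<Rightarrow> bool" where
  "spherically_locally_uniform_limit D h L \<longleftrightarrow>
     (\<forall>z\<in>D. \<exists>U. open U \<and> z \<in> U \<and>
        (\<forall>\<epsilon>>0. \<forall>\<^sub>F n in sequentially. \<forall>w\<in>U \<inter> D. spherical_dist (h n w) (L w) < \<epsilon>))"

definition normal_family_on :: "complex set \<Rightarrow> (complex \<Rightarrow> complex) set \<Rightarrow> bool" where
  "normal_family_on D G \<longleftrightarrow>
     (\<forall>g \<in> G. g meromorphic_on D) \<and>
     (\<forall>g. range g \<subseteq> G \<longrightarrow>
        (\<exists>r :: nat \<Rightarrow> nat. \<exists>L. strict_mono r \<and>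
           ((\<exists>l. l meromorphic_on D \<and> L = sphere_val l) \<or> L = (\<lambda>z. None)) \<and>
           spherically_locally_uniform_limit D (\<lambda>n. sphere_val (g (r n))) L))"

end

theory Submission
  imports Defs "HOL-Library.Diagonal_Subsequence" "HOL-Computational_Algebra.Fundamental_Theorem_Algebra"
begin

text \<open>
  Put \<open>G = - f''/(k f')\<close>. Then \<open>S_k(f) = - k \<Psi>_k(G)\<close>, where \<open>\<Psi>_k(h'/h) = h\<^bsup>(k)\<^esup>/h\<close>. If normality
  fails at a point where \<open>b\<close> is holomorphic, then rescaling \<open>\<rho> G(a + \<rho> z)\<close> produces a non-constant entire
  limit \<open>G\<close> with \<open>|G'| \<le> max(4, |G|\<^sup>2)\<close> everywhere, which is therefore of exponential type. By Hurwitz,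
  \<open>\<Psi>_k(G)\<close> either vanishes identically or has no zeros. The former forces \<open>G\<close> to be bounded, since
  \<open>\<Psi>_k(G)\<close> is close to \<open>G\<^sup>k\<close> where \<open>G\<close> is large. In the latter case \<open>\<Psi>_k(G) = exp(a z + c)\<close>, and
  comparing with \<open>G\<^sup>k\<close> shows that \<open>k G' - a G\<close> is bounded, hence constant; for the solutions \<open>G\<close> of
  this linear equation \<open>\<Psi>_k(G)\<close> has zeros. At a pole of \<open>b\<close> the maximum principle replaces the
  rescaling argument.
\<close>

subsection \<open>Growth of holomorphic functions\<close>

text \<open>Under the rescaling both |G'| and |G|^2 acquire the factor
  \<open>\<rho>\<^sup>2\<close>, which is why they are compared directly.
  \<open>riccati_poly k\<close> is homogeneous of weight k, so the omitted function acquires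
  \<open>\<rho> ^ k\<close> and tends to 0 as long as it is bounded. This fails at a pole of
  \<open>b\<close>. The growth bound makes the spherical derivative of the limit at most 4, so
  exponential type is an instance of the Clunie-Hayman theorem. \<open>slow_growth\<close> gives it
  with an explicit rate, using the derivative only where the function has modulus at most 1. The
  same lemma shows that G stays large on a unit ball around a point where it is very large, and it
  turns derivative bounds into local control. Normality is reached through \<open>controls\<close>:
  limits of holomorphic functions have no poles unless they are identically infinite, so the only
  thing to exclude is a sequence bounded at one point and unbounded at a nearby one. The condition k
  \<ge> 2 enters through the limit function: for G = exp the first Riccati polynomial is exp itself,
  without zeros, while the second is exp (exp + 1).\<close>

lemma deriv_bound_ball:
  fixes f :: "complex \<Rightarrow> complex"
  assumes hol: "f holomorphic_on ball w r" and r: "0 < r"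
    and B: "\<And>x. x \<in> ball w r \<Longrightarrow> norm (f x) \<le> B"
  shows "norm (deriv f w) \<le> B / r"
proof -
  \<comment> \<open>Cauchy's inequality needs continuity up to the circle, so it is applied for
    radii s < r, and s then tends to r.\<close>
  have "norm (deriv f w) * s \<le> B" if s: "0 < s" "s < r" for s
  proof -
    have sub: "cball w s \<subseteq> ball w r" using s by auto
    have "norm ((deriv ^^ 1) f w) \<le> fact 1 * B / s ^ 1"
    proof (rule Cauchy_inequality)
      show "f holomorphic_on ball w s" using hol s by (auto elim!: holomorphic_on_subset)
      show "continuous_on (cball w s) f"
        using hol sub holomorphic_on_imp_continuous_on continuous_on_subset by blast
      show "norm (f x) \<le> B" if "norm (w - x) = s" for x
        using that s by (intro B) (auto simp: dist_norm)
    qed fact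
    then show ?thesis using s by (simp add: field_simps)
  qed
  then have "eventually (\<lambda>s. norm (deriv f w) * s \<le> B) (at_left r)"
    using r by (auto simp: eventually_at_left[of 0])
  moreover have "((\<lambda>s. norm (deriv f w) * s) \<longlongrightarrow> norm (deriv f w) * r) (at_left r)"
    by (intro tendsto_intros)
  ultimately have "norm (deriv f w) * r \<le> B"
    by (intro tendsto_upperbound[OF _ _ trivial_limit_at_left_real])
  then show ?thesis using r by (simp add: field_simps)
qed

lemma deriv_bound_ball_diff:
  fixes f :: "complex \<Rightarrow> complex"
  assumes hol: "f holomorphic_on ball w r" and r: "0 < r"
    and B: "\<And>x. x \<in> ball w r \<Longrightarrow> norm (f x - c) \<le> B"
  shows "norm (deriv f w) \<le> B / r"
proof -
  have "(f has_field_derivative deriv f w) (at w)"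
    by (rule holomorphic_derivI[OF hol]) (use r in auto)
  then have "((\<lambda>x. f x - c) has_field_derivative deriv f w) (at w)"
    by (auto intro!: derivative_eq_intros)
  then have "deriv (\<lambda>x. f x - c) w = deriv f w" by (rule DERIV_imp_deriv)
  moreover have "norm (deriv (\<lambda>x. f x - c) w) \<le> B / r"
    using hol by (intro deriv_bound_ball r B holomorphic_intros)
  ultimately show ?thesis by simp
qed

section \<open>Logarithms and functions with positive real part on a disc\<close>

lemma holomorphic_log_ball:
  assumes "f holomorphic_on ball z r" "\<And>x. x \<in> ball z r \<Longrightarrow> f x \<noteq> 0"
  obtains F where "F holomorphic_on ball z r" "\<And>x. x \<in> ball z r \<Longrightarrow> f x = exp (F x)"
  using assms simply_connected_eq_holomorphic_log[of "ball z r"] 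
    convex_imp_simply_connected[OF convex_ball, of z r] by auto

text \<open>Schwarz's lemma for the Cayley transform of \<open>F\<close>.\<close>

lemma Schwarz_half_plane:
  assumes hol: "F holomorphic_on ball z d" and pos: "\<And>x. x \<in> ball z d \<Longrightarrow> 0 < Re (F x)"
    and x: "x \<in> ball z d"
  shows "norm (F x - F z) * d \<le> norm (x - z) * norm (F x + cnj (F z))"
proof -
  have d: "0 < d" using x by (metis ball_eq_empty empty_iff not_le)
  define c where "c = F z"
  have c: "0 < Re c" unfolding c_def by (rule pos) (use d in auto)
  define W where "W = (\<lambda>y. (F (z + of_real d * y) - c) / (F (z + of_real d * y) + cnj c))"
  have in_ball: "z + of_real d * y \<in> ball z d" if "norm y < 1" for y
    using that d by (simp add: dist_norm norm_mult)
  have nz: "F (z + of_real d * y) + cnj c \<noteq> 0" if "norm y < 1" for y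
    using pos[OF in_ball[OF that]] c by (auto simp: complex_eq_iff)
  have "(F \<circ> (\<lambda>y. z + of_real d * y)) holomorphic_on ball 0 1"
    by (rule holomorphic_on_compose_gen[OF _ hol]) (auto intro!: holomorphic_intros in_ball simp del: mem_ball)
  then have holW: "W holomorphic_on ball 0 1"
    unfolding W_def o_def using nz by (intro holomorphic_intros) auto
  \<comment> \<open>Since Re u and Re c are positive, this identity puts the Cayley transform
    \<open>W\<close> inside the unit disc.\<close>
  have sq: "(norm (u - c))\<^sup>2 = (norm (u + cnj c))\<^sup>2 - 4 * Re u * Re c" for u
    unfolding cmod_power2 by (simp add: power2_eq_square algebra_simps)
  have W1: "norm (W y) < 1" if "norm y < 1" for y
  proof -
    let ?u = "F (z + of_real d * y)"
    have "(norm (?u - c))\<^sup>2 < (norm (?u + cnj c))\<^sup>2"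
      unfolding sq using pos[OF in_ball[OF that]] c by simp
    then have "norm (?u - c) < norm (?u + cnj c)" by (rule power2_less_imp_less) simp
    then show ?thesis using nz[OF that] by (simp add: W_def norm_divide)
  qed
  define y where "y = (x - z) / of_real d"
  have y: "norm y < 1" "z + of_real d * y = x" and ny: "norm y = norm (x - z) / d"
    using x d by (auto simp: y_def norm_divide dist_norm norm_minus_commute)
  have "norm (W y) \<le> norm y"
    by (rule Schwarz_Lemma(1)[OF holW]) (use W1 y in \<open>auto simp: W_def c_def\<close>)
  then show ?thesis
    using nz[OF y(1)] d unfolding W_def y(2) ny c_def[symmetric] norm_divide by (simp add: field_simps)
qed

lemma Harnack_lower_bound:
  assumes hol: "F holomorphic_on ball z d" and pos: "\<And>x. x \<in> ball z d \<Longrightarrow> 0 < Re (F x)"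
    and x: "x \<in> ball z d"
  shows "Re (F z) * (d - norm (x - z)) \<le> Re (F x) * (d + norm (x - z))"
proof -
  have d: "0 < d" using x by (metis ball_eq_empty empty_iff not_le)
  define c where "c = F z"
  have c: "0 < Re c" unfolding c_def by (rule pos) (use d in auto)
  have le: "norm (F x - c) * d \<le> norm (x - z) * norm (F x + cnj c)"
    unfolding c_def by (rule Schwarz_half_plane[OF hol pos x])
  define r where "r = norm (x - z)"
  have r: "0 \<le> r" "r < d" using x by (auto simp: r_def dist_norm norm_minus_commute)
  define a where "a = Re (F x)" 
  define b where "b = Re c"
  have ab: "0 < a" "0 < b" using pos[OF x] c by (auto simp: a_def b_def)
  have "(norm (F x - c) * d)\<^sup>2 \<le> (r * norm (F x + cnj c))\<^sup>2"
    using le r_def by (intro power_mono) (use d in auto)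
  then have "d\<^sup>2 * (norm (F x - c))\<^sup>2 \<le> r\<^sup>2 * (norm (F x + cnj c))\<^sup>2"
    by (simp add: power_mult_distrib mult.commute)
  then have 1: "d\<^sup>2 * ((a - b)\<^sup>2 + (Im (F x) - Im c)\<^sup>2) \<le> r\<^sup>2 * ((a + b)\<^sup>2 + (Im (F x) - Im c)\<^sup>2)"
    by (simp add: cmod_power2 a_def b_def)
  have "r\<^sup>2 * (Im (F x) - Im c)\<^sup>2 \<le> d\<^sup>2 * (Im (F x) - Im c)\<^sup>2"
    using r by (intro mult_right_mono power_mono) auto
  then have "d\<^sup>2 * (a - b)\<^sup>2 \<le> r\<^sup>2 * (a + b)\<^sup>2"
    using 1 unfolding distrib_left by linarith
  then have "(d * (b - a))\<^sup>2 \<le> (r * (a + b))\<^sup>2"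
    unfolding power_mult_distrib power2_commute[of b a] .
  then have "d * (b - a) \<le> r * (a + b)"
    by (rule power2_le_imp_le) (use r ab in auto)
  then show ?thesis
    unfolding r_def a_def b_def c_def by (simp add: algebra_simps)
qed

text \<open>Hopf's boundary point argument at the point \<open>\<zeta>\<close> of \<open>{x. norm (f x) \<le> 1}\<close> closest to \<open>z\<close>: by
  Harnack's inequality \<open>ln (norm f)\<close> leaves \<open>\<zeta>\<close> towards \<open>z\<close> with slope at least
  \<open>ln (norm (f z)) / (2 * dist z \<zeta>)\<close>, and the bound on the derivative makes this at most \<open>M\<close>.\<close>

lemma slow_growth:
  assumes hol: "f holomorphic_on ball z R"
    and M: "\<And>x. x \<in> ball z R \<Longrightarrow> norm (f x) \<le> 1 \<Longrightarrow> norm (deriv f x) \<le> M"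
    and w: "w \<in> ball z R" "norm (f w) \<le> 1"
  shows "norm (f z) \<le> exp (2 * M * norm (z - w))"
proof (cases "norm (f z) \<le> 1")
  case True
  have "0 \<le> M" using M[OF w] norm_ge_zero order_trans by blast
  then have "(1::real) \<le> exp (2 * M * norm (z - w))" by simp
  then show ?thesis using True by linarith
next
  case False
  define K where "K = {x \<in> cball z (norm (z - w)). norm (f x) \<le> 1}"
  have sub: "cball z (norm (z - w)) \<subseteq> ball z R" using w by (auto simp: dist_norm)
  have contf: "continuous_on (ball z R) f" using hol holomorphic_on_imp_continuous_on by blast
  have "continuous_on (cball z (norm (z - w))) (\<lambda>x. norm (f x))"
    by (rule continuous_on_norm[OF continuous_on_subset[OF contf sub]])
  then have "closed (cball z (norm (z - w)) \<inter> (\<lambda>x. norm (f x)) -` {..1})"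
    by (intro continuous_closed_preimage) auto
  also have "cball z (norm (z - w)) \<inter> (\<lambda>x. norm (f x)) -` {..1} = K" by (auto simp: K_def)
  finally have "compact K"
    by (metis K_def bounded_cball bounded_subset compact_eq_bounded_closed mem_Collect_eq subsetI)
  moreover have "w \<in> K" using w by (auto simp: K_def dist_norm)
  ultimately obtain \<zeta> where \<zeta>: "\<zeta> \<in> K" and min: "\<And>y. y \<in> K \<Longrightarrow> dist z \<zeta> \<le> dist z y"
    using distance_attains_inf[of K z] compact_imp_closed by blast
  define d where "d = norm (\<zeta> - z)"
  have \<zeta>1: "norm (f \<zeta>) \<le> 1" and \<zeta>R: "\<zeta> \<in> ball z R" using \<zeta> sub by (auto simp: K_def)
  have d0: "0 < d" using \<zeta>1 False by (auto simp: d_def)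
  have dle: "d \<le> norm (z - w)" using min[OF \<open>w \<in> K\<close>] by (simp add: d_def dist_norm norm_minus_commute)
  have dR: "ball z d \<subseteq> ball z R" using \<zeta>R by (auto simp: d_def dist_norm norm_minus_commute)
  have big: "1 < norm (f x)" if "x \<in> ball z d" for x
  proof (rule ccontr)
    assume "\<not> 1 < norm (f x)"
    then have "x \<in> K" using that dle by (auto simp: K_def)
    from min[OF this] that show False by (simp add: d_def dist_norm norm_minus_commute)
  qed
  have "f holomorphic_on ball z d" using hol dR by (rule holomorphic_on_subset)
  moreover have "f x \<noteq> 0" if "x \<in> ball z d" for x using big[OF that] by auto
  ultimately obtain F where F: "F holomorphic_on ball z d" "\<And>x. x \<in> ball z d \<Longrightarrow> f x = exp (F x)"
    using holomorphic_log_ball by blast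
  have ReF: "norm (f x) = exp (Re (F x))" if "x \<in> ball z d" for x using F(2)[OF that] by simp
  have Rpos: "0 < Re (F x)" if "x \<in> ball z d" for x
    using big[OF that] ReF[OF that] by simp
  define L where "L = Re (F z)"
  have zd: "z \<in> ball z d" using d0 by simp
  have L0: "0 < L" unfolding L_def by (rule Rpos[OF zd])
  have step: "L / 2 \<le> norm ((f (\<zeta> + of_real t * (z - \<zeta>)) - f \<zeta>) / of_real t)" if t: "0 < t" "t < 1" for t
  proof -
    define x where "x = \<zeta> + of_real t * (z - \<zeta>)"
    have "x - z = of_real (1 - t) * (\<zeta> - z)" by (simp add: x_def algebra_simps)
    then have nx: "norm (x - z) = (1 - t) * d" using t by (simp add: norm_mult d_def del: of_real_diff)
    then have xd: "x \<in> ball z d" using t d0 by (simp add: dist_norm norm_minus_commute)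
    have "L * (d - (1 - t) * d) \<le> Re (F x) * (d + (1 - t) * d)"
      using Harnack_lower_bound[OF F(1) Rpos xd] by (simp add: nx L_def)
    then have "d * (L * t) \<le> d * (Re (F x) * (2 - t))" by (simp add: algebra_simps)
    then have "L * t \<le> Re (F x) * (2 - t)" using d0 by simp
    also have "\<dots> \<le> Re (F x) * 2" using Rpos[OF xd] t by (intro mult_left_mono) auto
    \<comment> \<open>\<open>exp y \<ge> 1 + y\<close> passes from the logarithm to
      \<open>norm (f x)\<close>, and \<open>norm (f \<zeta>) \<le> 1\<close> then turns the excess
      over 1 into a bound for the increment.\<close>
    finally have "1 + L * t / 2 \<le> 1 + Re (F x)" by simp
    also have "\<dots> \<le> norm (f x)" unfolding ReF[OF xd] by (rule exp_ge_add_one_self)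
    also have "\<dots> \<le> norm (f x - f \<zeta>) + 1" using norm_triangle_ineq2[of "f x" "f \<zeta>"] \<zeta>1 by linarith
    finally have "L * t / 2 \<le> norm (f x - f \<zeta>)" by simp
    then show ?thesis using t unfolding x_def[symmetric] by (simp add: norm_divide field_simps)
  qed
  have "(f has_field_derivative deriv f \<zeta>) (at \<zeta>)"
    using hol \<zeta>R by (intro holomorphic_derivI[of _ "ball z R"]) auto
  then have lim: "((\<lambda>h. (f (\<zeta> + h) - f \<zeta>) / h) \<longlongrightarrow> deriv f \<zeta>) (at 0)" by (simp add: DERIV_def)
  have zz: "z - \<zeta> \<noteq> 0" using d0 by (auto simp: d_def)
  have "filterlim (\<lambda>t::real. of_real t * (z - \<zeta>)) (at 0) (at_right 0)"
  proof (rule filterlim_atI)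
    show "((\<lambda>t::real. of_real t * (z - \<zeta>)) \<longlongrightarrow> 0) (at_right 0)"
      by (rule tendsto_eq_intros refl | simp)+
    show "\<forall>\<^sub>F t::real in at_right 0. of_real t * (z - \<zeta>) \<noteq> 0"
      using zz by (auto simp: eventually_at_right_less intro: eventually_mono[OF eventually_at_right_less])
  qed
  from filterlim_compose[OF lim this]
  have "((\<lambda>t::real. norm ((f (\<zeta> + of_real t * (z - \<zeta>)) - f \<zeta>) / (of_real t * (z - \<zeta>))) * d) \<longlongrightarrow> norm (deriv f \<zeta>) * d) (at_right 0)"
    by (intro tendsto_intros)
  moreover have "\<forall>\<^sub>F t::real in at_right 0. L / 2 \<le> norm ((f (\<zeta>
      + of_real t * (z - \<zeta>)) - f \<zeta>) / (of_real t * (z - \<zeta>))) * d"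
  proof -
    have "\<forall>\<^sub>F t::real in at_right 0. 0 < t \<and> t < 1"
      by (intro eventually_conj eventually_at_right_less eventually_at_rightI[of 0 1]) auto
    then show ?thesis
    proof eventually_elim
      case (elim t)
      then show ?case using step[of t] d0 by (simp add: norm_divide norm_mult d_def norm_minus_commute)
    qed
  qed
  ultimately have "L / 2 \<le> norm (deriv f \<zeta>) * d"
    by (intro tendsto_lowerbound[OF _ _ trivial_limit_at_right_real])
  also have "\<dots> \<le> M * norm (z - w)"
    using M[OF \<zeta>R \<zeta>1] dle d0 by (intro mult_mono) (auto intro: order_trans[OF norm_ge_zero])
  finally have "L \<le> 2 * M * norm (z - w)" by simp
  then show ?thesis using ReF[OF zd] by (simp add: L_def)
qed

subsection \<open>Logarithmic derivatives of higher order\<close>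

text \<open>For \<open>G = h'/h\<close> this is \<open>h\<^bsup>(j)\<^esup>/h\<close>, with \<open>j\<close> derivatives.\<close>

fun riccati_poly :: "nat \<Rightarrow> (complex \<Rightarrow> complex) \<Rightarrow> complex \<Rightarrow> complex" where
  "riccati_poly 0 G = (\<lambda>z. 1)"
| "riccati_poly (Suc j) G = (\<lambda>z. deriv (riccati_poly j G) z + G z * riccati_poly j G z)"

lemma riccati_poly_holomorphic:
  assumes "open S" "G holomorphic_on S"
  shows "riccati_poly j G holomorphic_on S"
  by (induction j) (use assms in \<open>auto intro!: holomorphic_intros holomorphic_deriv\<close>)

lemma deriv_eq_on_open:
  assumes "open S" "z \<in> S" "\<And>x. x \<in> S \<Longrightarrow> f x = g x"
  shows "deriv f z = deriv g z"
  using assms by (intro deriv_cong_ev eventually_nhds_in_open[THEN eventually_mono]) auto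

text \<open>If \<open>G\<close> and each differentiation count as weight 1, every term of
  \<open>riccati_poly j G\<close> has weight j.\<close>

lemma riccati_poly_rescale:
  assumes S: "open S" and G: "G holomorphic_on S" and z: "z0 + \<rho> * \<zeta> \<in> S"
  shows "riccati_poly j (\<lambda>\<zeta>. \<rho> * G (z0 + \<rho> * \<zeta>)) \<zeta> = \<rho> ^ j * riccati_poly j G (z0 + \<rho> * \<zeta>)"
  using z
proof (induction j arbitrary: \<zeta>)
  case (Suc j)
  define T where "T = (\<lambda>\<zeta>. z0 + \<rho> * \<zeta>) -` S"
  have T: "open T" unfolding T_def
    by (intro continuous_open_vimage[OF S]) (auto intro!: continuous_intros)
  have \<zeta>: "\<zeta> \<in> T" using Suc.prems by (simp add: T_def)
  have "deriv (riccati_poly j (\<lambda>\<zeta>. \<rho> * G (z0 + \<rho> * \<zeta>))) \<zeta> = deriv (\<lambda>\<zeta>. \<rho> ^ j * riccati_poly j G (z0 + \<rho> * \<zeta>)) \<zeta>"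
    by (rule deriv_eq_on_open[OF T \<zeta>]) (use Suc.IH in \<open>auto simp: T_def\<close>)
  also have "\<dots> = \<rho> ^ j * (deriv (riccati_poly j G) (z0 + \<rho> * \<zeta>) * \<rho>)"
  proof (rule DERIV_imp_deriv)
    have d: "(riccati_poly j G has_field_derivative deriv (riccati_poly j G) (z0 + \<rho> * \<zeta>)) (at (z0 + \<rho> * \<zeta>))"
      by (rule holomorphic_derivI[OF riccati_poly_holomorphic[OF S G] S Suc.prems])
    have "((\<lambda>\<zeta>. z0 + \<rho> * \<zeta>) has_field_derivative \<rho>) (at \<zeta>)"
      by (auto intro!: derivative_eq_intros)
    from DERIV_chain2[OF d this]
    show "((\<lambda>\<zeta>. \<rho> ^ j * riccati_poly j G (z0 + \<rho> * \<zeta>)) has_field_derivative \<rho> ^ j * (deriv (riccati_poly j G) (z0 + \<rho> * \<zeta>) * \<rho>)) (at \<zeta>)"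
      by (rule DERIV_cmult)
  qed
  finally show ?case using Suc.IH[OF Suc.prems] by (simp add: algebra_simps)
qed simp

text \<open>\<open>riccati_cofactor j u\<close> is \<open>riccati_poly j G / G ^ j\<close> for \<open>u = 1 / G\<close>.\<close>

fun riccati_cofactor :: "nat \<Rightarrow> (complex \<Rightarrow> complex) \<Rightarrow> complex \<Rightarrow> complex" where
  "riccati_cofactor 0 u = (\<lambda>z. 1)"
| "riccati_cofactor (Suc j) u = (\<lambda>z. riccati_cofactor j u z + u z * deriv (riccati_cofactor j u) z
     - of_nat j * deriv u z * riccati_cofactor j u z)"

lemma riccati_cofactor_holomorphic:
  assumes "open S" "u holomorphic_on S"
  shows "riccati_cofactor j u holomorphic_on S"
  by (induction j) (use assms in \<open>auto intro!: holomorphic_intros holomorphic_deriv\<close>)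

text \<open>With u = 1 / G one has G' = - G^2 u', so every term of the derivative of
  \<open>G ^ j * q\<close> and of \<open>G * G ^ j * q\<close> contains \<open>G ^ (j + 1)\<close>.
  The other factor is the recursion of \<open>riccati_cofactor\<close>.\<close>

lemma riccati_poly_eq_cofactor:
  assumes S: "open S" and G: "G holomorphic_on S" and nz: "\<And>x. x \<in> S \<Longrightarrow> G x \<noteq> 0" and z: "z \<in> S"
  shows "riccati_poly j G z = G z ^ j * riccati_cofactor j (\<lambda>x. inverse (G x)) z"
  using z
proof (induction j arbitrary: z)
  case (Suc j)
  let ?u = "\<lambda>x. inverse (G x)" let ?q = "riccati_cofactor j ?u"
  have u: "?u holomorphic_on S" using G nz by (intro holomorphic_intros) auto
  have dG: "(G has_field_derivative deriv G z) (at z)"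
    by (rule holomorphic_derivI[OF G S Suc.prems])
  have dq: "(?q has_field_derivative deriv ?q z) (at z)"
    by (rule holomorphic_derivI[OF riccati_cofactor_holomorphic[OF S u] S Suc.prems])
  have Gz: "G z \<noteq> 0" using nz Suc.prems by auto
  have du: "deriv ?u z = - deriv G z / (G z)\<^sup>2"
    by (rule DERIV_imp_deriv) (use Gz in \<open>auto intro!: derivative_eq_intros dG simp: power2_eq_square field_simps\<close>)
  have "deriv (riccati_poly j G) z = deriv (\<lambda>z. G z ^ j * ?q z) z"
    by (rule deriv_eq_on_open[OF S Suc.prems]) (rule Suc.IH)
  also have "\<dots> = of_nat j * G z ^ (j - 1) * deriv G z * ?q z + G z ^ j * deriv ?q z"
    by (rule DERIV_imp_deriv) (auto intro!: derivative_eq_intros dG dq)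
  finally have dpsi: "deriv (riccati_poly j G) z = of_nat j * G z ^ (j - 1) * deriv G z * ?q z
      + G z ^ j * deriv ?q z" .
  \<comment> \<open>For j = 0 the exponent \<open>j - 1\<close> is truncated to 0, which is harmless
    because the coefficient \<open>of_nat j\<close> vanishes.\<close>
  have alg: "of_nat j * g ^ (j - 1) * g' * q + g ^ j * q' + g * (g ^ j * q)
      = g ^ Suc j * (q + inverse g * q' - of_nat j * (- g' / g\<^sup>2) * q)"
    if "g \<noteq> 0" for g g' q q' :: complex
    using that by (cases j) (simp_all add: field_simps power2_eq_square)
  show ?case
    unfolding riccati_poly.simps riccati_cofactor.simps dpsi du Suc.IH[OF Suc.prems] by (rule alg[OF Gz])
qed simp

text \<open>Each correction in the recursion of \<open>riccati_cofactor\<close> has u or its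
  derivative as a factor, hence is of order \<epsilon> by Cauchy's estimate, which costs half of the
  radius at each of the j steps. The constant depends on R and j only.\<close>

lemma riccati_cofactor_bound:
  fixes R :: real
  assumes R: "0 < R"
  shows "\<exists>C\<ge>0. \<forall>u w \<epsilon>. u holomorphic_on ball w R \<longrightarrow> \<epsilon> \<le> 1 \<longrightarrow> (\<forall>x\<in>ball w R. norm (u x) \<le> \<epsilon>) \<longrightarrow>
           (\<forall>x\<in>ball w (R / 2 ^ j). norm (riccati_cofactor j u x - 1) \<le> C * \<epsilon>)"
proof (induction j)
  case 0
  show ?case by (intro exI[of _ 0]) auto
next
  case (Suc j)
  then obtain C where C: "0 \<le> C" and IH: "\<And>u w \<epsilon> x. u holomorphic_on ball w R \<Longrightarrow> \<epsilon> \<le> 1 \<Longrightarrow>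
     (\<And>x. x \<in> ball w R \<Longrightarrow> norm (u x) \<le> \<epsilon>) \<Longrightarrow> x \<in> ball w (R / 2 ^ j) \<Longrightarrow> norm (riccati_cofactor j u x - 1) \<le> C * \<epsilon>"
    by blast
  define s where "s = 2 ^ Suc j / R"
  have s: "0 < s" using R by (simp add: s_def)
  show ?case
  \<comment> \<open>The three summands come from q - 1, u q' and j u' q, where \<open>s\<close> is
    the reciprocal of the radius left for Cauchy's estimate.\<close>
  proof (intro exI[of _ "C + C * s + real j * s * (1 + C)"] conjI allI impI ballI)
    fix u w \<epsilon> x
    assume u: "u holomorphic_on ball w R" and \<epsilon>1: "\<epsilon> \<le> 1" and ub: "\<forall>x\<in>ball w R. norm (u x) \<le> \<epsilon>"
      and x: "x \<in> ball w (R / 2 ^ Suc j)"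
    let ?q = "riccati_cofactor j u"
    have \<epsilon>0: "0 \<le> \<epsilon>" using ub R by (auto intro!: order_trans[OF norm_ge_zero] dest!: bspec[of _ _ w])
    have half: "R / 2 ^ Suc j + R / 2 ^ Suc j = R / 2 ^ j" by simp
    have sub1: "ball x (R / 2 ^ Suc j) \<subseteq> ball w (R / 2 ^ j)"
    proof
      fix y assume "y \<in> ball x (R / 2 ^ Suc j)"
      then have "dist w y < R / 2 ^ Suc j + R / 2 ^ Suc j"
        using x dist_triangle[of w y x] by (simp only: mem_ball)
      then show "y \<in> ball w (R / 2 ^ j)" using half by simp
    qed
    have "R / 2 ^ j \<le> R / 1" using R by (intro divide_left_mono) auto
    then have sub2: "ball w (R / 2 ^ j) \<subseteq> ball w R" by auto
    have xin: "x \<in> ball x (R / 2 ^ Suc j)" using R by simp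
    have IH': "norm (?q y - 1) \<le> C * \<epsilon>" if "y \<in> ball w (R / 2 ^ j)" for y
      by (rule IH[OF u \<epsilon>1 _ that]) (use ub in auto)
    have q: "?q holomorphic_on ball w R" by (rule riccati_cofactor_holomorphic[OF open_ball u])
    have "norm (deriv u x) \<le> \<epsilon> / (R / 2 ^ Suc j)"
    proof (rule deriv_bound_ball)
      show "u holomorphic_on ball x (R / 2 ^ Suc j)"
        using u order_trans[OF sub1 sub2] by (rule holomorphic_on_subset)
      show "norm (u y) \<le> \<epsilon>" if "y \<in> ball x (R / 2 ^ Suc j)" for y
        using ub that sub1 sub2 by blast
    qed (use R in auto)
    then have du: "norm (deriv u x) \<le> \<epsilon> * s" by (simp add: s_def field_simps)
    have "norm (deriv ?q x) \<le> C * \<epsilon> / (R / 2 ^ Suc j)"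
    proof (rule deriv_bound_ball_diff)
      show "?q holomorphic_on ball x (R / 2 ^ Suc j)"
        using q order_trans[OF sub1 sub2] by (rule holomorphic_on_subset)
      show "norm (?q y - 1) \<le> C * \<epsilon>" if "y \<in> ball x (R / 2 ^ Suc j)" for y
        using IH' that sub1 by blast
    qed (use R in auto)
    then have dq: "norm (deriv ?q x) \<le> C * \<epsilon> * s" by (simp add: s_def field_simps)
    have q1: "norm (?q x - 1) \<le> C * \<epsilon>" using IH' sub1 xin by blast
    have "norm (?q x) \<le> 1 + norm (?q x - 1)" using norm_triangle_ineq[of 1 "?q x - 1"] by simp
    also have "\<dots> \<le> 1 + C * 1" using q1 mult_left_mono[OF \<epsilon>1 C] by linarith
    finally have q2: "norm (?q x) \<le> 1 + C" by simp
    have "norm (u x) \<le> 1" using ub \<epsilon>1 sub1 sub2 xin by fastforce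
    then have a: "norm (u x * deriv ?q x) \<le> 1 * (C * \<epsilon> * s)"
      unfolding norm_mult by (intro mult_mono dq) auto
    have b: "norm (of_nat j * deriv u x * ?q x) \<le> real j * (\<epsilon> * s) * (1 + C)"
      unfolding norm_mult norm_of_nat using \<epsilon>0 s C by (intro mult_mono du q2) auto
    have split: "riccati_cofactor (Suc j) u x - 1 = (?q x - 1) + u x * deriv ?q x - of_nat j * deriv u x * ?q x"
      by simp
    have "norm (riccati_cofactor (Suc j) u x - 1) \<le> norm (?q x - 1) + norm (u x * deriv ?q x)
        + norm (of_nat j * deriv u x * ?q x)"
      unfolding split using norm_triangle_ineq4[of "(?q x - 1)
          + u x * deriv ?q x" "of_nat j * deriv u x * ?q x"]
        norm_triangle_ineq[of "?q x - 1" "u x * deriv ?q x"] by linarith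
    also have "\<dots> \<le> C * \<epsilon> + 1 * (C * \<epsilon> * s) + real j * (\<epsilon> * s) * (1 + C)"
      using q1 a b by linarith
    also have "\<dots> = (C + C * s + real j * s * (1 + C)) * \<epsilon>" by (simp add: algebra_simps)
    finally show "norm (riccati_cofactor (Suc j) u x - 1) \<le> (C + C * s + real j * s * (1 + C)) * \<epsilon>" .
  qed (use C s in auto)
qed

subsection \<open>Entire functions of exponential type\<close>

definition exponential_type :: "(complex \<Rightarrow> complex) \<Rightarrow> bool" where
  "exponential_type f \<longleftrightarrow> (\<exists>C\<ge>0. \<exists>c\<ge>0. \<forall>z. norm (f z) \<le> C * exp (c * norm z))"

lemma exponential_typeI:
  assumes "0 \<le> C" "0 \<le> c" "\<And>z. norm (f z) \<le> C * exp (c * norm z)"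
  shows "exponential_type f"
  using assms unfolding exponential_type_def by blast

lemma exponential_typeE:
  assumes "exponential_type f"
  obtains C c where "0 \<le> C" "0 \<le> c" "\<And>z. norm (f z) \<le> C * exp (c * norm z)"
  using assms unfolding exponential_type_def by blast

lemma exponential_type_add:
  assumes "exponential_type f" "exponential_type g"
  shows "exponential_type (\<lambda>z. f z + g z)"
proof -
  obtain C c where f: "0 \<le> C" "0 \<le> c" "\<And>z. norm (f z) \<le> C * exp (c * norm z)"
    using exponential_typeE[OF assms(1)] by blast
  obtain D d where g: "0 \<le> D" "0 \<le> d" "\<And>z. norm (g z) \<le> D * exp (d * norm z)"
    using exponential_typeE[OF assms(2)] by blast
  show ?thesis
  proof (rule exponential_typeI)
    fix z
    have "norm (f z + g z) \<le> C * exp (c * norm z) + D * exp (d * norm z)"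
      using norm_triangle_ineq[of "f z" "g z"] f(3)[of z] g(3)[of z] by linarith
    also have "\<dots> \<le> C * exp ((c + d) * norm z) + D * exp ((c + d) * norm z)"
      using f(1,2) g(1,2) by (intro add_mono mult_left_mono) (auto intro!: mult_right_mono)
    finally show "norm (f z + g z) \<le> (C + D) * exp ((c + d) * norm z)"
      by (simp add: distrib_right)
  qed (use f g in auto)
qed

lemma exponential_type_mult:
  assumes "exponential_type f" "exponential_type g"
  shows "exponential_type (\<lambda>z. f z * g z)"
proof -
  obtain C c where f: "0 \<le> C" "0 \<le> c" "\<And>z. norm (f z) \<le> C * exp (c * norm z)"
    using exponential_typeE[OF assms(1)] by blast
  obtain D d where g: "0 \<le> D" "0 \<le> d" "\<And>z. norm (g z) \<le> D * exp (d * norm z)"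
    using exponential_typeE[OF assms(2)] by blast
  show ?thesis
  proof (rule exponential_typeI)
    fix z
    have "norm (f z * g z) \<le> (C * exp (c * norm z)) * (D * exp (d * norm z))"
      unfolding norm_mult using f g by (intro mult_mono) auto
    also have "\<dots> = (C * D) * exp ((c + d) * norm z)"
      unfolding distrib_right exp_add by (simp only: mult_ac)
    finally show "norm (f z * g z) \<le> (C * D) * exp ((c + d) * norm z)" .
  qed (use f g in auto)
qed

lemma exponential_type_deriv:
  assumes hol: "f holomorphic_on UNIV" and "exponential_type f"
  shows "exponential_type (deriv f)"
proof -
  obtain C c where f: "0 \<le> C" "0 \<le> c" "\<And>z. norm (f z) \<le> C * exp (c * norm z)"
    using exponential_typeE[OF assms(2)] by blast
  show ?thesis
  proof (rule exponential_typeI)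
    fix z
    have "norm (deriv f z) \<le> C * exp (c * (norm z + 1)) / 1"
    proof (rule deriv_bound_ball)
      fix x assume "x \<in> ball z 1"
      then have "norm x \<le> norm z + 1"
        using norm_triangle_ineq2[of x z] by (simp add: dist_norm norm_minus_commute)
      then have "C * exp (c * norm x) \<le> C * exp (c * (norm z + 1))"
        using f by (intro mult_left_mono) (auto intro!: mult_left_mono)
      then show "norm (f x) \<le> C * exp (c * (norm z + 1))" using f(3)[of x] by linarith
    qed (use hol in \<open>auto intro: holomorphic_on_subset\<close>)
    then show "norm (deriv f z) \<le> (C * exp c) * exp (c * norm z)"
      by (simp add: distrib_left exp_add mult_ac)
  qed (use f in auto)
qed

lemma exponential_type_riccati_poly:
  assumes "G holomorphic_on UNIV" "exponential_type G"
  shows "exponential_type (riccati_poly j G)"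
proof (induction j)
  case 0
  show ?case by (rule exponential_typeI[of 1 0]) auto
next
  case (Suc j)
  show ?case unfolding riccati_poly.simps
    by (intro exponential_type_add exponential_type_mult exponential_type_deriv assms Suc
        riccati_poly_holomorphic open_UNIV)
qed

text \<open>Q = exp P with Re P of linear growth, so P grows linearly and Liouville makes it affine.
  The result has the form of a differential equation because only the logarithmic derivative of Q is
  used later.\<close>

lemma zero_free_exponential_type:
  assumes hol: "Q holomorphic_on UNIV" and nz: "\<And>z. Q z \<noteq> 0" and et: "exponential_type Q"
  obtains a where "\<And>z. deriv Q z = a * Q z"
proof -
  obtain C c where C: "0 \<le> C" "0 \<le> c" "\<And>z. norm (Q z) \<le> C * exp (c * norm z)"
    using exponential_typeE[OF et] by blast
  have "simply_connected (UNIV :: complex set)" by (simp add: convex_imp_simply_connected)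
  then obtain P where P: "P holomorphic_on UNIV" "\<And>z. Q z = exp (P z)"
    using hol nz simply_connected_eq_holomorphic_log[of UNIV] by auto
  have C0: "0 < C"
    using C(3)[of 0] nz[of 0] by (metis C(1) exp_gt_zero linorder_not_le mult_eq_0_iff nz norm_le_zero_iff order_le_less zero_less_norm_iff)
  define A where "A = \<bar>ln C\<bar>"
  have ReP: "Re (P z) \<le> A + c * norm z" for z
  proof -
    have "exp (Re (P z)) \<le> C * exp (c * norm z)" using C(3)[of z] P(2)[of z] by simp
    also have "\<dots> = exp (ln C + c * norm z)" using C0 by (simp add: exp_add)
    also have "\<dots> \<le> exp (A + c * norm z)" by (simp add: A_def)
    finally show ?thesis by simp
  qed
  text \<open>The Borel-Caratheodory estimate, from Schwarz's lemma for \<open>M - P\<close> on \<open>ball 0 (2 * norm z + 1)\<close>.\<close>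
  have lin: "norm (P z - P 0) \<le> 2 * (A + c * (2 * norm z + 1) + 1 - Re (P 0))" for z
  proof -
    \<comment> \<open>This radius gives d - |z| = |z| + 1, which is positive for all z and
      comparable to |z|. The summand 1 in \<open>M\<close> makes Re F strictly positive.\<close>
    define d where "d = 2 * norm z + 1"
    define M where "M = A + c * d + 1"
    define F where "F = (\<lambda>x. of_real M - P x)"
    have d: "0 < d" by (simp add: d_def add_nonneg_pos)
    have "F holomorphic_on ball 0 d" unfolding F_def
      using P(1) by (intro holomorphic_intros) (auto intro: holomorphic_on_subset)
    moreover have pos: "0 < Re (F x)" if "x \<in> ball 0 d" for x
    proof -
      have "c * norm x \<le> c * d" using that C(2) by (intro mult_left_mono) auto
      then show ?thesis using ReP[of x] by (simp add: F_def M_def)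
    qed
    moreover have "z \<in> ball 0 d" by (simp add: d_def add_nonneg_pos)
    ultimately have "norm (F z - F 0) * d \<le> norm (z - 0) * norm (F z + cnj (F 0))"
      by (rule Schwarz_half_plane)
    also have "norm (F z + cnj (F 0)) \<le> norm (F z - F 0) + 2 * Re (F 0)"
    proof -
      have "F z + cnj (F 0) = (F z - F 0) + of_real (2 * Re (F 0))"
        by (simp add: complex_eq_iff)
      then show ?thesis using norm_triangle_ineq[of "F z - F 0" "of_real (2 * Re (F 0))"] pos[of 0] d
        by (simp only: norm_of_real) auto
    qed
    finally have "norm (F z - F 0) * d \<le> norm z * (norm (F z - F 0) + 2 * Re (F 0))"
      by (simp add: mult_left_mono)
    then have "norm (F z - F 0) * (norm z + 1) \<le> 2 * Re (F 0) * norm z"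
      by (simp add: d_def algebra_simps)
    also have "\<dots> \<le> 2 * Re (F 0) * (norm z + 1)" using pos[of 0] d by (intro mult_left_mono) auto
    finally have "norm (F z - F 0) \<le> 2 * Re (F 0)"
      by (rule mult_right_le_imp_le) (simp add: add_nonneg_pos)
    moreover have "norm (F z - F 0) = norm (P z - P 0)" by (simp add: F_def norm_minus_commute)
    ultimately show ?thesis by (simp add: F_def M_def d_def)
  qed
  define q where "q = \<bar>Re (P 0)\<bar>"
  define B where "B = 2 * (A + 3 * c + 1 + q) + norm (P 0)"
  have "norm (P z) \<le> B * norm z ^ 1" if "1 \<le> norm z" for z
  proof -
    have "norm (P z) \<le> norm (P z - P 0) + norm (P 0)" using norm_triangle_ineq2[of "P z" "P 0"] by linarith
    also have "\<dots> \<le> 2 * (A + c * (2 * norm z + 1) + 1 - Re (P 0)) + norm (P 0)" using lin[of z] by linarith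
    also have "\<dots> \<le> 2 * (A * norm z + c * (3 * norm z) + norm z + q * norm z) + norm (P 0) * norm z"
    proof -
      have m: "x \<le> x * norm z" if "0 \<le> x" for x
        using mult_left_mono[OF \<open>1 \<le> norm z\<close> that] by simp
      have "c * (2 * norm z + 1) \<le> c * (3 * norm z)" using that C(2) by (intro mult_left_mono) auto
      moreover have "A \<le> A * norm z" "q \<le> q * norm z" "norm (P 0) \<le> norm (P 0) * norm z"
        by (auto intro!: m simp: A_def q_def)
      moreover have "- Re (P 0) \<le> q" by (simp add: q_def)
      moreover have "2 * (A + X + 1 - R) + p \<le> 2 * (A' + Y + n + q') + p'"
        if "X \<le> Y" "A \<le> A'" "q \<le> q'" "p \<le> p'" "- R \<le> q" "1 \<le> n" for X Y A' q' p' n R p :: real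
        using that by argo
      ultimately show ?thesis using that by blast
    qed
    also have "\<dots> = B * norm z ^ 1" by (simp add: B_def algebra_simps)
    finally show ?thesis .
  qed
  then have Plin: "P z = P 0 + deriv P 0 * z" for z
    using Liouville_polynomial[OF P(1), of 1 B 1 z] by simp
  have Qexp: "Q z = exp (P 0 + deriv P 0 * z)" for z
    using P(2)[of z] arg_cong[OF Plin[of z], of exp] by (rule trans)
  have "deriv Q z = deriv P 0 * Q z" for z
    unfolding Qexp[of z] unfolding Qexp[abs_def]
    by (rule DERIV_imp_deriv) (auto intro!: derivative_eq_intros)
  then show ?thesis by (rule that)
qed

subsection \<open>Zeros of Riccati polynomials of entire functions\<close>

text \<open>\<open>riccati_poly j G\<close> as a polynomial in \<open>G\<close>, for solutions of \<open>G' = s G + C\<close>.\<close>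

fun ode_poly :: "complex \<Rightarrow> complex \<Rightarrow> nat \<Rightarrow> complex poly" where
  "ode_poly s C 0 = 1"
| "ode_poly s C (Suc j) = pderiv (ode_poly s C j) * [:C, s:] + [:0, 1:] * ode_poly s C j"

lemma degree_ode_poly: "degree (ode_poly s C j) = j \<and> ode_poly s C j \<noteq> 0"
proof (induction j)
  case (Suc j)
  let ?p = "ode_poly s C j"
  have nz: "?p \<noteq> 0" and dp: "degree ?p = j" using Suc by auto
  have d2: "degree ([:0, 1:] * ?p) = Suc j" using nz dp by (simp add: degree_mult_eq)
  have "degree (pderiv ?p * [:C, s:]) \<le> degree (pderiv ?p) + degree [:C, s:]" by (rule degree_mult_le)
  also have "\<dots> \<le> (j - 1) + 1" using dp by (intro add_mono) (auto simp: degree_pderiv)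
  finally have d1: "degree (pderiv ?p * [:C, s:]) \<le> (j - 1) + 1" .
  \<comment> \<open>For j = 0 the bound \<open>(j - 1) + 1\<close> is 1 by truncated subtraction and
    too weak, but then the derivative vanishes.\<close>
  have d1': "degree (pderiv ?p * [:C, s:]) < Suc j"
  proof (cases j)
    case 0
    then have "pderiv ?p = 0" using dp by (simp add: pderiv_eq_0_iff)
    then show ?thesis by simp
  qed (use d1 in auto)
  have "degree (ode_poly s C (Suc j)) = Suc j"
    unfolding ode_poly.simps using d1' d2 degree_add_eq_right[of "pderiv ?p * [:C, s:]" "[:0, 1:] * ?p"] by simp
  then show ?case by (metis degree_0 nat.distinct(1))
qed simp

lemma riccati_poly_ode:
  assumes G: "G holomorphic_on UNIV" and ode: "\<And>z. deriv G z = s * G z + C"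
  shows "riccati_poly j G = (\<lambda>z. poly (ode_poly s C j) (G z))"
proof (induction j)
  case (Suc j)
  have "deriv (\<lambda>z. poly (ode_poly s C j) (G z)) z = poly (pderiv (ode_poly s C j)) (G z) * (s * G z + C)" for z
  proof (rule DERIV_imp_deriv)
    have "(G has_field_derivative s * G z + C) (at z)"
      using holomorphic_derivI[OF G open_UNIV, of z] ode[of z] by simp
    from DERIV_chain2[OF poly_DERIV this]
    show "((\<lambda>z. poly (ode_poly s C j) (G z)) has_field_derivative poly (pderiv (ode_poly s C j)) (G z) * (s * G z + C)) (at z)" .
  qed
  then show ?case unfolding riccati_poly.simps Suc by (auto simp: algebra_simps)
qed simp

text \<open>The solutions are explicit: affine if s = 0, otherwise A exp (s z) - C / s. A
  non-constant one can only miss the stationary value, where s v + C = 0.\<close>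

lemma linear_ode_range:
  assumes G: "G holomorphic_on UNIV" and ode: "\<And>z. deriv G z = s * G z + C"
    and nonconst: "deriv G z0 \<noteq> 0" and v: "s * v + C \<noteq> 0"
  shows "\<exists>z. G z = v"
proof (cases "s = 0")
  case True
  have "((\<lambda>z. G z - C * z) has_field_derivative 0) (at z)" for z
    using holomorphic_derivI[OF G open_UNIV, of z] ode[of z] True
    by (auto intro!: derivative_eq_intros)
  then obtain A where A: "\<And>z. G z - C * z = A"
    using has_field_derivative_zero_constant[of UNIV "\<lambda>z. G z - C * z"] by auto
  have "C \<noteq> 0" using nonconst ode[of z0] True by simp
  then have "G ((v - A) / C) = v" using A[of "(v - A) / C"] by simp
  then show ?thesis by blast
next
  case False
  have "((\<lambda>z. (G z + C / s) * exp (- s * z)) has_field_derivative 0) (at z)" for z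
  proof -
    have "(G has_field_derivative s * G z + C) (at z)"
      using holomorphic_derivI[OF G open_UNIV, of z] ode[of z] by simp
    then show ?thesis using False by (auto intro!: derivative_eq_intros simp: field_simps)
  qed
  then obtain A where A: "\<And>z. (G z + C / s) * exp (- s * z) = A"
    using has_field_derivative_zero_constant[of UNIV "\<lambda>z. (G z + C / s) * exp (- s * z)"] by auto
  have GA: "G z = A * exp (s * z) - C / s" for z
    using A[of z] by (simp add: exp_minus field_simps)
  have "A \<noteq> 0" using nonconst ode[of z0] GA[of z0] False by auto
  moreover have "v + C / s \<noteq> 0" using v False by (simp add: field_simps)
  ultimately have "exp (s * (Ln ((v + C / s) / A) / s)) = (v + C / s) / A"
    using False by simp
  then have "G (Ln ((v + C / s) / A) / s) = v" using GA \<open>A \<noteq> 0\<close> by simp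
  then show ?thesis by blast
qed

text \<open>Without a zero, every root of \<open>ode_poly s C k\<close> would be missed by G, hence
  stationary. At a stationary B the polynomial has the value \<open>B ^ k\<close>, so B = 0 and C =
  0. Then 0 would be the only root, but it is simple and the degree k is at least 2.\<close>

lemma linear_ode_riccati_zero:
  assumes G: "G holomorphic_on UNIV" and ode: "\<And>z. deriv G z = s * G z + C"
    and nonconst: "deriv G z0 \<noteq> 0" and k: "2 \<le> k"
  shows "\<exists>z. riccati_poly k G z = 0"
proof (rule ccontr)
  assume no_zero: "\<not> ?thesis"
  let ?p = "ode_poly s C"
  have root: "s * v + C = 0" if "poly (?p k) v = 0" for v
    using linear_ode_range[OF G ode nonconst, of v] no_zero that riccati_poly_ode[OF G ode] by metis
  have "0 < degree (?p k)" using degree_ode_poly[of s C k] k by simp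
  then obtain B where B: "poly (?p k) B = 0" using alg_closed_imp_poly_has_root by blast
  have sB: "s * B + C = 0" by (rule root[OF B])
  have lin0: "poly [:C, s:] B = 0" using sB by (simp add: algebra_simps)
  \<comment> \<open>The derivative term carries the factor C + s B = 0, so only the multiplication
    by the variable survives.\<close>
  have "poly (?p j) B = B ^ j" for j
  proof (induction j)
    case (Suc j)
    then show ?case unfolding ode_poly.simps poly_add poly_mult lin0 by simp
  qed simp
  then have "B = 0" using B by auto
  then have C0: "C = 0" using sB by simp
  have s0: "s \<noteq> 0" using nonconst ode[of z0] C0 by auto
  have step: "poly (pderiv P * [:C, s:] + [:0, 1:] * P) 0 = 0"
      "poly (pderiv (pderiv P * [:C, s:] + [:0, 1:] * P)) 0 = s * poly (pderiv P) 0 + poly P 0" for P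
    using C0 by (simp_all add: pderiv_mult pderiv_add pderiv_pCons pderiv_smult)
  \<comment> \<open>The root 0 is simple, because the derivative there is a power of s.\<close>
  have "poly (?p (Suc j)) 0 = 0 \<and> poly (pderiv (?p (Suc j))) 0 = s ^ j" for j
  proof (induction j)
    case 0
    show ?case unfolding ode_poly.simps(2) step by simp
  next
    case (Suc j)
    then show ?case unfolding ode_poly.simps(2)[of s C "Suc j"] step by simp
  qed
  then have at0: "poly (?p (k - 1)) 0 = 0" "poly (pderiv (?p (k - 1))) 0 = s ^ (k - 2)"
    using k by (metis Suc_diff_Suc Suc_1 Suc_le_lessD diff_Suc_1 numeral_2_eq_2)+
  \<comment> \<open>\<open>r\<close> is \<open>?p k\<close> divided by the variable; its value at 0
    is \<open>s * s ^ (k - 2)\<close>, which is not 0.\<close>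
  define r where "r = smult s (pderiv (?p (k - 1))) + ?p (k - 1)"
  have pk: "?p k = [:0, 1:] * r"
  proof -
    have "?p k = ?p (Suc (k - 1))" using k by simp
    also have "\<dots> = [:0, 1:] * r" unfolding ode_poly.simps r_def C0 by (simp add: algebra_simps)
    finally show ?thesis .
  qed
  have "degree r = k - 1"
  proof -
    have "degree (?p k) = k" "?p k \<noteq> 0" using degree_ode_poly by blast+
    then show ?thesis unfolding pk by (auto simp: degree_mult_eq)
  qed
  then have "0 < degree r" using k by simp
  then obtain v where v: "poly r v = 0" using alg_closed_imp_poly_has_root by blast
  then have "poly (?p k) v = 0" unfolding pk by simp
  then have "v = 0" using root[of v] s0 C0 by simp
  then have "s * s ^ (k - 2) = 0" using v at0 by (simp add: r_def)
  then show False using s0 by simp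
qed

section \<open>Entire functions obeying the growth bound inherited from the rescaling\<close>

context
  fixes G :: "complex \<Rightarrow> complex"
  assumes G: "G holomorphic_on UNIV"
    and growth: "\<And>z. norm (deriv G z) \<le> max 4 ((norm (G z))\<^sup>2)"
begin

text \<open>For T \<ge> 2 the growth bound gives |G'| \<le> T^2 where |G| \<le> T, so f = G / T has
  derivative at most T where |f| \<le> 1. If |G x| \<le> T, then \<open>slow_growth\<close> between
  w and x bounds |G w| by T exp (2 T).\<close>

lemma large_on_unit_ball:
  assumes T: "2 \<le> T" and w: "T * exp (2 * T) < norm (G w)" and x: "x \<in> ball w 1"
  shows "T < norm (G x)"
proof (rule ccontr)
  assume small: "\<not> T < norm (G x)"
  define f where "f = (\<lambda>x. G x / of_real T)"
  have f: "f holomorphic_on UNIV" unfolding f_def using G T by (intro holomorphic_intros) auto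
  have df: "deriv f y = deriv G y / of_real T" for y
    unfolding f_def using holomorphic_derivI[OF G open_UNIV, of y]
    by (intro DERIV_imp_deriv DERIV_cdivide) simp
  have nf: "norm (f y) = norm (G y) / T" for y using T by (simp add: f_def norm_divide)
  have "norm (f w) \<le> exp (2 * T * norm (w - x))"
  proof (rule slow_growth[of f w 1])
    fix y assume "norm (f y) \<le> 1"
    then have "norm (G y) \<le> T" using T by (simp add: nf field_simps)
    then have "(norm (G y))\<^sup>2 \<le> T\<^sup>2" by (intro power_mono) auto
    moreover have "2\<^sup>2 \<le> T\<^sup>2" using T by (intro power_mono) auto
    ultimately have "norm (deriv G y) \<le> T\<^sup>2" using growth[of y] by simp
    then show "norm (deriv f y) \<le> T" using T by (simp add: df norm_divide field_simps power2_eq_square)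
  qed (use x small T f in \<open>auto simp: nf field_simps intro: holomorphic_on_subset\<close>)
  also have "\<dots> \<le> exp (2 * T)"
    using x T mult_left_mono[of "norm (w - x)" 1 "2 * T"] by (simp add: dist_norm)
  finally have "norm (G w) \<le> T * exp (2 * T)" using T by (simp add: nf field_simps)
  then show False using w by simp
qed

lemma inverse_small:
  assumes T: "2 \<le> T" and w: "T * exp (2 * T) < norm (G w)" 
  shows "(\<lambda>x. inverse (G x)) holomorphic_on ball w 1"
    and "x \<in> ball w 1 \<Longrightarrow> G x \<noteq> 0"
    and "x \<in> ball w 1 \<Longrightarrow> norm (inverse (G x)) \<le> 1 / T"
proof -
  have big: "T < norm (G x)" if "x \<in> ball w 1" for x
    by (rule large_on_unit_ball[OF T w that])
  show nz: "G x \<noteq> 0" if "x \<in> ball w 1" for x using big[OF that] T by auto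
  show "(\<lambda>x. inverse (G x)) holomorphic_on ball w 1"
    using nz by (intro holomorphic_intros holomorphic_on_subset[OF G]) auto
  show "norm (inverse (G x)) \<le> 1 / T" if "x \<in> ball w 1"
    using big[OF that] T by (simp add: norm_inverse inverse_eq_divide norm_divide frac_le)
qed

lemma bounded_imp_deriv_zero:
  assumes "\<And>w. norm (G w) \<le> K"
  shows "deriv G z = 0"
proof -
  have "G constant_on UNIV"
    by (rule Liouville_theorem[OF G]) (use assms in \<open>auto simp: bounded_iff\<close>)
  then obtain c where "G = (\<lambda>z. c)" by (auto simp: constant_on_def)
  then show ?thesis by simp
qed

lemma riccati_poly_nonzero:
  assumes nonconst: "deriv G z0 \<noteq> 0"
  shows "\<exists>z. riccati_poly k G z \<noteq> 0"
proof (rule ccontr)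
  assume zero: "\<not> ?thesis"
  obtain C where C: "0 \<le> C" and bound: "\<And>u w \<epsilon> x. u holomorphic_on ball w 1 \<Longrightarrow> \<epsilon> \<le> 1 \<Longrightarrow>
     (\<forall>x\<in>ball w 1. norm (u x) \<le> \<epsilon>) \<Longrightarrow> x \<in> ball w (1 / 2 ^ k) \<Longrightarrow> norm (riccati_cofactor k u x - 1) \<le> C * \<epsilon>"
    using riccati_cofactor_bound[of 1 k] by auto
  \<comment> \<open>T \<ge> 2 serves \<open>inverse_small\<close>, and C / T \<le> 1 / 2 keeps the
    cofactor away from 0.\<close>
  define T where "T = 2 + 2 * C"
  have T: "2 \<le> T" "C * (1 / T) \<le> 1 / 2" using C by (auto simp: T_def field_simps)
  have "norm (G w) \<le> T * exp (2 * T)" for w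
  proof (rule ccontr)
    assume "\<not> norm (G w) \<le> T * exp (2 * T)"
    then have w: "T * exp (2 * T) < norm (G w)" by simp
    let ?q = "riccati_cofactor k (\<lambda>x. inverse (G x))"
    have "norm (?q w - 1) \<le> C * (1 / T)"
      by (rule bound[OF inverse_small(1)[OF T(1) w]]) (use inverse_small(3)[OF T(1) w] T in auto)
    then have "norm (?q w - 1) \<le> 1 / 2" using T(2) by linarith
    then have "?q w \<noteq> 0" by auto
    moreover have "riccati_poly k G w = G w ^ k * ?q w"
      by (rule riccati_poly_eq_cofactor[of "ball w 1"])
        (use G inverse_small(2)[OF T(1) w] in \<open>auto intro: holomorphic_on_subset\<close>)
    ultimately show False using zero inverse_small(2)[OF T(1) w, of w] by auto
  qed
  then show False using bounded_imp_deriv_zero nonconst by blast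
qed

text \<open>The entire function \<open>k G' - a G\<close> is bounded. Where \<open>G\<close> is large, \<open>u = 1/G\<close> is small and
  \<open>G\<^sup>k q = riccati_poly k G\<close> with \<open>q\<close> close to \<open>1\<close>, so \<open>k G' - a G = - G q'/q\<close>; this makes
  \<open>G'/G\<close> bounded, hence \<open>q - 1 = O(u)\<close> nearby and \<open>G q'\<close> bounded.\<close>

lemma riccati_poly_exponential_imp_linear_ode:
  assumes Q: "\<And>z. deriv (riccati_poly k G) z = a * riccati_poly k G z" and k: "0 < k"
  obtains s C where "\<And>z. deriv G z = s * G z + C"
proof -
  \<comment> \<open>The cofactor bound is applied twice: from radius 1 down to \<open>\<rho>\<close>
    with the crude bound 1 / T for u, then from \<open>r\<close> down to \<open>r'\<close> with a
    bound proportional to |u w|.\<close>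
  define \<rho> :: real where "\<rho> = 1 / 2 ^ k"
  have \<rho>: "0 < \<rho>" "\<rho> \<le> 1" by (auto simp: \<rho>_def)
  obtain C where C: "0 \<le> C" and bound: "\<And>u w \<epsilon> x. u holomorphic_on ball w 1 \<Longrightarrow> \<epsilon> \<le> 1 \<Longrightarrow>
     (\<forall>x\<in>ball w 1. norm (u x) \<le> \<epsilon>) \<Longrightarrow> x \<in> ball w \<rho> \<Longrightarrow> norm (riccati_cofactor k u x - 1) \<le> C * \<epsilon>"
    unfolding \<rho>_def using riccati_cofactor_bound[of 1 k] by auto
  define r where "r = \<rho> / 2"
  define r' where "r' = r / 2 ^ k"
  have r: "0 < r" "r < \<rho>" "0 < r'" "r' \<le> r" 
    using \<rho> by (auto simp: r_def r'_def field_simps)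
  obtain C' where C': "0 \<le> C'" and bound': "\<And>u w \<epsilon> x. u holomorphic_on ball w r \<Longrightarrow> \<epsilon> \<le> 1 \<Longrightarrow>
     (\<forall>x\<in>ball w r. norm (u x) \<le> \<epsilon>) \<Longrightarrow> x \<in> ball w r' \<Longrightarrow> norm (riccati_cofactor k u x - 1) \<le> C' * \<epsilon>"
    unfolding r'_def using riccati_cofactor_bound[OF r(1), of k] by auto
  \<comment> \<open>This will bound |G'/G|: it is |a| plus a bound for |q'| / |q|, where |q'| \<le>
    1 / (2 r) by Cauchy's estimate and |q| \<ge> 1 / 2.\<close>
  define y where "y = norm a + 1 / r"
  have y: "0 < y" using r by (auto simp: y_def intro: add_nonneg_pos)
  \<comment> \<open>The summands give T \<ge> 2, C / T \<le> 1 / 2 and exp y / T \<le> 1; the last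
    provides \<epsilon> \<le> 1 in the second cofactor bound.\<close>
  define T where "T = 2 + 2 * C + exp y"
  have T: "2 \<le> T" "C * (1 / T) \<le> 1 / 2" "exp y * (1 / T) \<le> 1"
    using C by (auto simp: T_def field_simps add_nonneg_pos add_pos_pos)
  define K where "K = T * exp (2 * T)"
  define D where "D = (\<lambda>z. of_nat k * deriv G z - a * G z)"
  define B where "B = max (2 * C' * exp y / r') (real k * max 4 (K\<^sup>2) + norm a * K)"
  have DB: "norm (D w) \<le> B" for w
  proof (cases "norm (G w) \<le> K")
    case True
    have "norm (D w) \<le> norm (of_nat k * deriv G w) + norm (a * G w)"
      unfolding D_def by (rule norm_triangle_ineq4)
    also have "\<dots> \<le> real k * max 4 (K\<^sup>2) + norm a * K"
    proof -
      have "(norm (G w))\<^sup>2 \<le> K\<^sup>2" using True by (intro power_mono) auto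
      then have "norm (deriv G w) \<le> max 4 (K\<^sup>2)" using growth[of w] by linarith
      then show ?thesis unfolding norm_mult norm_of_nat using True
        by (intro add_mono mult_left_mono) auto
    qed
    finally show ?thesis by (simp add: B_def)
  next
    case False
    then have w: "T * exp (2 * T) < norm (G w)" by (simp add: K_def)
    let ?u = "\<lambda>x. inverse (G x)" 
    define q where "q = riccati_cofactor k ?u"
    have sub: "ball w r \<subseteq> ball w \<rho>" "ball w \<rho> \<subseteq> ball w 1" "ball w r \<subseteq> ball w 1" "ball w r' \<subseteq> ball w r"
      using r \<rho> by auto
    have u: "?u holomorphic_on ball w 1" and nz: "\<And>x. x \<in> ball w 1 \<Longrightarrow> G x \<noteq> 0"
      and ub: "\<And>x. x \<in> ball w 1 \<Longrightarrow> norm (?u x) \<le> 1 / T"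
      using inverse_small[OF T(1) w] by auto
    have hq: "q holomorphic_on ball w 1" unfolding q_def by (rule riccati_cofactor_holomorphic[OF open_ball u])
    have q1: "norm (q x - 1) \<le> 1 / 2" if "x \<in> ball w \<rho>" for x
    proof -
      have "norm (q x - 1) \<le> C * (1 / T)" unfolding q_def
        by (rule bound[OF u _ _ that]) (use ub T in auto)
      then show ?thesis using T by linarith
    qed
    have q2: "1 / 2 \<le> norm (q x)" if "x \<in> ball w \<rho>" for x
      using q1[OF that] norm_triangle_ineq2[of 1 "1 - q x"] by (simp add: norm_minus_commute)
    have dq: "norm (deriv q x) \<le> 1 / 2 / r" if "x \<in> ball w r" for x
    proof (rule deriv_bound_ball_diff)
      have "ball x r \<subseteq> ball w \<rho>"
      proof
        fix z assume "z \<in> ball x r"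
        then show "z \<in> ball w \<rho>" using that dist_triangle[of w z x] by (simp add: r_def)
      qed
      then show "q holomorphic_on ball x r" "\<And>z. z \<in> ball x r \<Longrightarrow> norm (q z - 1) \<le> 1 / 2"
        using q1 holomorphic_on_subset[OF hq order_trans[OF _ sub(2)]] by blast+
    qed (use r in auto)
    \<comment> \<open>This is the equation for \<open>riccati_poly k G = G ^ k * q\<close>, divided
      by \<open>G ^ (k - 1)\<close>.\<close>
    have ode: "of_nat k * deriv G x * q x + G x * deriv q x = a * G x * q x" if x: "x \<in> ball w 1" for x
    proof -
      have eq: "riccati_poly k G z = G z ^ k * q z" if "z \<in> ball w 1" for z
        unfolding q_def
        by (rule riccati_poly_eq_cofactor[OF open_ball _ _ that])
          (use G nz in \<open>auto intro: holomorphic_on_subset\<close>)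
      have dG: "(G has_field_derivative deriv G x) (at x)" by (rule holomorphic_derivI[OF G]) auto
      have dq: "(q has_field_derivative deriv q x) (at x)" by (rule holomorphic_derivI[OF hq open_ball x])
      have "deriv (riccati_poly k G) x = deriv (\<lambda>z. G z ^ k * q z) x"
        by (rule deriv_eq_on_open[OF open_ball x eq])
      also have "\<dots> = of_nat k * G x ^ (k - 1) * deriv G x * q x + G x ^ k * deriv q x"
        by (rule DERIV_imp_deriv) (auto intro!: derivative_eq_intros dG dq)
      also have "\<dots> = G x ^ (k - 1) * (of_nat k * deriv G x * q x + G x * deriv q x)"
        using k by (cases k) (auto simp: algebra_simps)
      finally have "G x ^ (k - 1) * (of_nat k * deriv G x * q x + G x * deriv q x) = a * (G x ^ k * q x)"
        using Q[of x] eq[OF x] by simp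
      also have "\<dots> = G x ^ (k - 1) * (a * G x * q x)"
        using k by (cases k) (auto simp: algebra_simps)
      finally show ?thesis using nz[OF x] by simp
    qed
    have logG: "norm (deriv G x / G x) \<le> y" if x: "x \<in> ball w r" for x
    proof -
      have xs: "x \<in> ball w 1" "x \<in> ball w \<rho>" using x sub by auto
      have qnz: "q x \<noteq> 0" "G x \<noteq> 0" using q2[OF xs(2)] nz[OF xs(1)] by auto
      have "of_nat k * (deriv G x / G x) = a - deriv q x / q x"
        using ode[OF xs(1)] qnz by (simp add: field_simps)
      then have "real k * norm (deriv G x / G x) = norm (a - deriv q x / q x)"
        by (metis norm_mult norm_of_nat)
      also have "\<dots> \<le> norm a + norm (deriv q x) / norm (q x)"
        using norm_triangle_ineq4[of a "deriv q x / q x"] by (simp add: norm_divide)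
      also have "norm (deriv q x) / norm (q x) \<le> (1 / 2 / r) / (1 / 2)"
        using dq[OF x] q2[OF xs(2)] r by (intro frac_le) auto
      finally have "real k * norm (deriv G x / G x) \<le> y" by (simp add: y_def)
      moreover have "1 * norm (deriv G x / G x) \<le> real k * norm (deriv G x / G x)"
        using k by (intro mult_right_mono) auto
      ultimately show ?thesis by linarith
    qed
    have "?u holomorphic_on ball w r" using u sub(3) by (rule holomorphic_on_subset)
    moreover have "?u x \<noteq> 0" if "x \<in> ball w r" for x using nz sub(3) that by auto
    ultimately obtain F where F: "F holomorphic_on ball w r" "\<And>x. x \<in> ball w r \<Longrightarrow> ?u x = exp (F x)"
      using holomorphic_log_ball[of ?u w r] by blast
    have wr: "w \<in> ball w r" "w \<in> ball w r'" "w \<in> ball w 1" "w \<in> ball w \<rho>" using r \<rho> by auto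
    \<comment> \<open>A logarithm of u has derivative - G'/G, bounded by y, and the ball has radius
      below 1, so |u| exceeds |u w| by a factor of at most exp y.\<close>
    have u_le: "norm (?u x) \<le> exp y * norm (?u w)" if x: "x \<in> ball w r" for x
    proof -
      have dF: "(F has_field_derivative - (deriv G z / G z)) (at z)" if z: "z \<in> ball w r" for z
      proof -
        have dF: "(F has_field_derivative deriv F z) (at z)" by (rule holomorphic_derivI[OF F(1) open_ball z])
        have dG: "(G has_field_derivative deriv G z) (at z)" by (rule holomorphic_derivI[OF G]) auto
        have Gz: "G z \<noteq> 0" using nz z sub(3) by auto
        have "deriv ?u z = deriv (\<lambda>x. exp (F x)) z"
          by (rule deriv_eq_on_open[OF open_ball z]) (rule F(2))
        also have "\<dots> = exp (F z) * deriv F z"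
          by (rule DERIV_imp_deriv) (auto intro!: derivative_eq_intros dF)
        also have "deriv ?u z = - (deriv G z / G z) * ?u z"
          by (rule DERIV_imp_deriv) (use Gz in \<open>auto intro!: derivative_eq_intros dG simp: field_simps\<close>)
        finally have "exp (F z) * deriv F z = exp (F z) * (- (deriv G z / G z))"
          unfolding F(2)[OF z] by (simp only: mult.commute)
        then have "deriv F z = - (deriv G z / G z)" unfolding mult_left_cancel[OF exp_not_eq_zero] .
        then show ?thesis using dF by simp
      qed
      have "norm (F x - F w) \<le> y * norm (x - w)"
      proof (rule field_differentiable_bound[of "ball w r" F "\<lambda>z. - (deriv G z / G z)"])
        fix z assume z: "z \<in> ball w r"
        show "(F has_field_derivative - (deriv G z / G z)) (at z within ball w r)"
          by (rule has_field_derivative_at_within[OF dF[OF z]])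
        show "norm (- (deriv G z / G z)) \<le> y" unfolding norm_minus_cancel by (rule logG[OF z])
      qed (use x wr in auto)
      also have "\<dots> \<le> y * 1" using x r \<rho> y by (intro mult_left_mono) (auto simp: dist_norm norm_minus_commute)
      finally have "Re (F x) \<le> y + Re (F w)" using complex_Re_le_cmod[of "F x - F w"] by simp
      then show ?thesis using F(2)[OF x] F(2)[OF wr(1)] by (simp flip: exp_add)
    qed
    have "exp y * norm (?u w) \<le> exp y * (1 / T)" using ub[OF wr(3)] by (intro mult_left_mono) auto
    then have \<epsilon>1: "exp y * norm (?u w) \<le> 1" using T by linarith
    \<comment> \<open>Here \<epsilon> is proportional to |u w| = 1 / |G w|, not merely to 1 / T.
      This is what compensates the factor G w in G q'.\<close>
    have "norm (deriv q w) \<le> C' * (exp y * norm (?u w)) / r'"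
    proof (rule deriv_bound_ball_diff)
      show "q holomorphic_on ball w r'" using hq order_trans[OF sub(4,3)] by (rule holomorphic_on_subset)
      show "norm (q x - 1) \<le> C' * (exp y * norm (?u w))" if "x \<in> ball w r'" for x
        unfolding q_def by (rule bound'[OF holomorphic_on_subset[OF u sub(3)] \<epsilon>1 _ that]) (use u_le in blast)
    qed (use r in auto)
    then have dqw: "norm (G w) * norm (deriv q w) \<le> C' * exp y / r'"
      using nz[OF wr(3)] r(3) by (simp add: norm_divide field_simps)
    have "D w * q w = - (G w * deriv q w)" using ode[OF wr(3)] by (simp add: D_def algebra_simps add_eq_0_iff)
    then have "norm (D w) * norm (q w) = norm (G w) * norm (deriv q w)"
      by (metis norm_minus_cancel norm_mult)
    then have "norm (D w) * norm (q w) \<le> C' * exp y / r'" using dqw by simp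
    moreover have "norm (D w) * (1 / 2) \<le> norm (D w) * norm (q w)"
      using q2[OF wr(4)] by (intro mult_left_mono) auto
    ultimately have "norm (D w) \<le> 2 * C' * exp y / r'" by simp
    then show ?thesis by (simp add: B_def)
  qed
  have "D holomorphic_on UNIV" unfolding D_def using G by (intro holomorphic_intros holomorphic_deriv) auto
  then have "D constant_on UNIV"
    by (rule Liouville_theorem) (use DB in \<open>auto simp: bounded_iff\<close>)
  then obtain c where c: "\<And>z. D z = c" by (auto simp: constant_on_def)
  have "deriv G z = (a / of_nat k) * G z + c / of_nat k" for z
    using c[of z] k by (simp add: D_def field_simps)
  then show ?thesis by (rule that)
qed

proposition riccati_poly_has_zero:
  assumes et: "exponential_type G" and nonconst: "deriv G z0 \<noteq> 0" and k: "2 \<le> k"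
  shows "\<exists>z. riccati_poly k G z = 0"
proof (rule ccontr)
  assume no_zero: "\<not> ?thesis"
  have "riccati_poly k G holomorphic_on UNIV" "exponential_type (riccati_poly k G)"
    using G et by (auto intro: riccati_poly_holomorphic exponential_type_riccati_poly)
  then obtain a where "\<And>z. deriv (riccati_poly k G) z = a * riccati_poly k G z"
    using zero_free_exponential_type[of "riccati_poly k G"] no_zero by blast
  then obtain s C where "\<And>z. deriv G z = s * G z + C"
    using riccati_poly_exponential_imp_linear_ode[of k a] k by auto
  then show False using linear_ode_riccati_zero[OF G _ nonconst k] no_zero by blast
qed

end

subsection \<open>Locally uniform limits on the plane\<close>

text \<open>Holomorphy is required only eventually on each ball, because the rescaled functions live
  on growing discs and not on the plane.\<close>

definition tends_entire :: "(nat \<Rightarrow> complex \<Rightarrow> complex) \<Rightarrow> (complex \<Rightarrow> complex) \<Rightarrow> bool" where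
  "tends_entire F f \<longleftrightarrow> (\<forall>R. \<forall>\<^sub>F n in sequentially. F n holomorphic_on ball 0 R) \<and>
     (\<forall>R. uniform_limit (cball 0 R) F f sequentially)"

lemma tends_entireD:
  assumes "tends_entire F f"
  shows "\<forall>\<^sub>F n in sequentially. F n holomorphic_on ball 0 R" "uniform_limit (cball 0 R) F f sequentially"
  using assms by (auto simp: tends_entire_def)

lemma tends_entire_pointwise:
  assumes "tends_entire F f"
  shows "(\<lambda>n. F n z) \<longlonglongrightarrow> f z"
  using tendsto_uniform_limitI[OF tends_entireD(2)[OF assms, of "norm z"], of z] by simp

lemma tends_entire_holomorphic:
  assumes F: "tends_entire F f"
  shows "f holomorphic_on UNIV"
proof -
  have "f holomorphic_on ball 0 R" if R: "0 < R" for R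
  proof (rule holomorphic_uniform_limit)
    show "\<forall>\<^sub>F n in sequentially. continuous_on (cball 0 R) (F n) \<and> F n holomorphic_on ball 0 R"
      using tends_entireD(1)[OF F, of "R + 1"]
    proof eventually_elim
      case (elim n)
      have "cball 0 R \<subseteq> (ball 0 (R + 1) :: complex set)" "ball 0 R \<subseteq> (ball 0 (R + 1) :: complex set)" by auto
      then show ?case using elim
        by (metis holomorphic_on_imp_continuous_on holomorphic_on_subset)
    qed
  qed (use tends_entireD(2)[OF F] in auto)
  then have "f field_differentiable at z" for z
    using holomorphic_on_imp_differentiable_at[of f "ball 0 (norm z + 1)" z] by (simp add: add_nonneg_pos)
  then show ?thesis by (simp add: holomorphic_on_def)
qed

lemma tends_entire_const: "tends_entire (\<lambda>n z. c) (\<lambda>z. c)"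
  by (auto simp: tends_entire_def intro: uniform_limit_const)

lemma tends_entire_add:
  assumes "tends_entire F f" "tends_entire G g"
  shows "tends_entire (\<lambda>n z. F n z + G n z) (\<lambda>z. f z + g z)"
  unfolding tends_entire_def
proof (intro conjI allI)
  fix R
  show "\<forall>\<^sub>F n in sequentially. (\<lambda>z. F n z + G n z) holomorphic_on ball 0 R"
    using tends_entireD(1)[OF assms(1), of R] tends_entireD(1)[OF assms(2), of R]
    by eventually_elim (intro holomorphic_intros)
  show "uniform_limit (cball 0 R) (\<lambda>n z. F n z + G n z) (\<lambda>z. f z + g z) sequentially"
    using assms by (intro uniform_limit_add tends_entireD)
qed

lemma tends_entire_diff:
  assumes "tends_entire F f" "tends_entire G g"
  shows "tends_entire (\<lambda>n z. F n z - G n z) (\<lambda>z. f z - g z)"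
  unfolding tends_entire_def
proof (intro conjI allI)
  fix R
  show "\<forall>\<^sub>F n in sequentially. (\<lambda>z. F n z - G n z) holomorphic_on ball 0 R"
    using tends_entireD(1)[OF assms(1), of R] tends_entireD(1)[OF assms(2), of R]
    by eventually_elim (intro holomorphic_intros)
  show "uniform_limit (cball 0 R) (\<lambda>n z. F n z - G n z) (\<lambda>z. f z - g z) sequentially"
    using assms by (intro uniform_limit_minus tends_entireD)
qed

lemma tends_entire_mult:
  assumes "tends_entire F f" "tends_entire G g"
  shows "tends_entire (\<lambda>n z. F n z * G n z) (\<lambda>z. f z * g z)"
  unfolding tends_entire_def
proof (intro conjI allI)
  fix R
  show "\<forall>\<^sub>F n in sequentially. (\<lambda>z. F n z * G n z) holomorphic_on ball 0 R"
    using tends_entireD(1)[OF assms(1), of R] tends_entireD(1)[OF assms(2), of R]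
    by eventually_elim (intro holomorphic_intros)
  have bd: "bounded (h ` cball 0 R)" if "h holomorphic_on UNIV" for h :: "complex \<Rightarrow> complex"
    by (intro compact_imp_bounded compact_continuous_image holomorphic_on_imp_continuous_on
        holomorphic_on_subset[OF that]) auto
  show "uniform_limit (cball 0 R) (\<lambda>n z. F n z * G n z) (\<lambda>z. f z * g z) sequentially"
    using assms by (intro uniform_lim_mult tends_entireD bd) (auto intro: tends_entire_holomorphic)
qed

lemma tends_entire_deriv:
  assumes F: "tends_entire F f"
  shows "tends_entire (\<lambda>n. deriv (F n)) (deriv f)"
  unfolding tends_entire_def
proof (intro conjI allI)
  fix R
  show "\<forall>\<^sub>F n in sequentially. deriv (F n) holomorphic_on ball 0 R"
    using tends_entireD(1)[OF F, of R] by eventually_elim (auto intro: holomorphic_deriv)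
  have f: "f holomorphic_on UNIV" using F by (rule tends_entire_holomorphic)
  show "uniform_limit (cball 0 R) (\<lambda>n. deriv (F n)) (deriv f) sequentially"
  proof (rule uniform_limitI)
    fix e :: real assume e: "0 < e"
    have "\<forall>\<^sub>F n in sequentially. \<forall>x\<in>cball 0 (R + 1). dist (F n x) (f x) < e / 2"
      using uniform_limitD[OF tends_entireD(2)[OF F]] e half_gt_zero by blast
    then show "\<forall>\<^sub>F n in sequentially. \<forall>x\<in>cball 0 R. dist (deriv (F n) x) (deriv f x) < e"
      using tends_entireD(1)[OF F, of "R + 1"]
    proof eventually_elim
      case (elim n)
      show ?case
      proof
        fix x :: complex assume x: "x \<in> cball 0 R"
        have sub: "ball x 1 \<subseteq> ball 0 (R + 1)"
        proof
          fix y assume "y \<in> ball x 1"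
          then show "y \<in> ball 0 (R + 1)" using x dist_triangle[of 0 y x] by simp
        qed
        have xin: "x \<in> ball 0 (R + 1)" using x by simp
        have "((\<lambda>y. F n y - f y) has_field_derivative deriv (F n) x - deriv f x) (at x)"
          by (intro DERIV_diff holomorphic_derivI[OF elim(2) open_ball xin] holomorphic_derivI[OF f open_UNIV]) auto
        then have "deriv (\<lambda>y. F n y - f y) x = deriv (F n) x - deriv f x" by (rule DERIV_imp_deriv)
        moreover have "norm (deriv (\<lambda>y. F n y - f y) x) \<le> e / 2 / 1"
        proof (rule deriv_bound_ball)
          show "(\<lambda>y. F n y - f y) holomorphic_on ball x 1"
            using elim(2) sub f by (intro holomorphic_intros) (auto intro: holomorphic_on_subset)
          show "norm (F n y - f y) \<le> e / 2" if "y \<in> ball x 1" for y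
          proof -
            have "y \<in> cball 0 (R + 1)" using that sub by (auto intro: less_imp_le)
            then show ?thesis using elim(1) by (auto simp: dist_norm intro: less_imp_le)
          qed
        qed auto
        ultimately show "dist (deriv (F n) x) (deriv f x) < e" using e by (simp add: dist_norm)
      qed
    qed
  qed
qed

lemma tends_entire_riccati_poly:
  assumes F: "tends_entire F f"
  shows "tends_entire (\<lambda>n. riccati_poly j (F n)) (riccati_poly j f)"
proof (induction j)
  case (Suc j)
  show ?case unfolding riccati_poly.simps
    by (intro tends_entire_add tends_entire_mult tends_entire_deriv F Suc)
qed (simp add: tends_entire_const)

lemma tends_entire_subseq:
  assumes F: "tends_entire F f" and r: "strict_mono r"
  shows "tends_entire (\<lambda>n. F (r n)) f"
  unfolding tends_entire_def
proof (intro conjI allI)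
  fix R
  have lim: "filterlim r sequentially sequentially" using r by (rule filterlim_subseq)
  show "\<forall>\<^sub>F n in sequentially. F (r n) holomorphic_on ball 0 R"
    using eventually_compose_filterlim[OF tends_entireD(1)[OF F] lim] .
  show "uniform_limit (cball 0 R) (\<lambda>n. F (r n)) f sequentially"
    using filterlim_compose[OF tends_entireD(2)[OF F] lim] .
qed

lemma tends_entire_Hurwitz:
  assumes F: "tends_entire F f" and nz: "\<And>R. \<forall>\<^sub>F n in sequentially. \<forall>z\<in>ball 0 R. F n z \<noteq> 0"
    and w: "f w \<noteq> 0"
  shows "f z \<noteq> 0"
proof
  assume fz: "f z = 0"
  define R where "R = norm z + norm w + 1"
  have in_ball: "z \<in> ball 0 R" "w \<in> ball 0 R" by (auto simp: R_def add_nonneg_pos add_pos_nonneg)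
  have "\<forall>\<^sub>F n in sequentially. F n holomorphic_on ball 0 R \<and> (\<forall>z\<in>ball 0 R. F n z \<noteq> 0)"
    by (intro eventually_conj nz tends_entireD(1)[OF F])
  then obtain N where N: "\<And>n. N \<le> n \<Longrightarrow> F n holomorphic_on ball 0 R" "\<And>n z. N \<le> n \<Longrightarrow> z \<in> ball 0 R \<Longrightarrow> F n z \<noteq> 0"
    unfolding eventually_sequentially by blast
  have "f z \<noteq> 0"
  \<comment> \<open>Hurwitz's theorem wants every member of the sequence zero-free, hence the shift
    by N. The values at z and w rule out a constant limit.\<close>
  proof (rule Hurwitz_no_zeros[of "ball 0 R" "\<lambda>n. F (n + N)" f])
    show "f holomorphic_on ball 0 R" using tends_entire_holomorphic[OF F] by (rule holomorphic_on_subset) auto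
    show "uniform_limit K (\<lambda>n. F (n + N)) f sequentially" if "compact K" "K \<subseteq> ball 0 R" for K
    proof -
      have "uniform_limit K F f sequentially"
        using that by (intro uniform_limit_on_subset[OF tends_entireD(2)[OF F, of R]]) auto
      then show ?thesis by (rule filterlim_compose) (rule filterlim_add_const_nat_at_top)
    qed
    show "\<not> f constant_on ball 0 R" using in_ball fz w by (metis constant_on_def)
  qed (use N in_ball in auto)
  then show False using fz by simp
qed

text \<open>No single term need be holomorphic on the whole plane, so Montel's theorem is applied on
  the balls of radius k + 1, to a tail of the sequence. A diagonal subsequence then converges on
  every closed ball.\<close>

lemma Montel_entire:
  fixes F :: "nat \<Rightarrow> complex \<Rightarrow> complex"
  assumes hol: "\<And>R. \<forall>\<^sub>F n in sequentially. F n holomorphic_on ball 0 R"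
    and bounded: "\<And>R. \<exists>B. \<forall>\<^sub>F n in sequentially. \<forall>z\<in>ball 0 R. norm (F n z) \<le> B"
  obtains f r where "strict_mono (r :: nat \<Rightarrow> nat)" "tends_entire (\<lambda>n. F (r n)) f"
proof -
  define P where "P k s \<longleftrightarrow> (\<exists>f. uniform_limit (cball 0 (real k)) (F \<circ> s) f sequentially)"
      for k and s :: "nat \<Rightarrow> nat"
  interpret subseqs P
  proof
    fix k and s :: "nat \<Rightarrow> nat"
    assume s: "strict_mono s"
    define S where "S = (ball 0 (real k + 1) :: complex set)"
    obtain B where "\<forall>\<^sub>F n in sequentially. \<forall>z\<in>S. norm (F n z) \<le> B"
      unfolding S_def using bounded by blast
    then have "\<forall>\<^sub>F n in sequentially. F n holomorphic_on S \<and> (\<forall>z\<in>S. norm (F n z) \<le> B)"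
      unfolding S_def using hol by (intro eventually_conj) auto
    then obtain N where N: "\<And>n. N \<le> n \<Longrightarrow> F n holomorphic_on S" "\<And>n z. N \<le> n \<Longrightarrow> z \<in> S \<Longrightarrow> norm (F n z) \<le> B"
      unfolding eventually_sequentially by blast
    have sN: "N \<le> s (n + N)" for n using seq_suble[OF s, of "n + N"] by linarith
    obtain g r where gr: "g holomorphic_on S" "strict_mono (r :: nat \<Rightarrow> nat)"
      "\<And>K. compact K \<Longrightarrow> K \<subseteq> S \<Longrightarrow> uniform_limit K ((\<lambda>n. F (s (n + N))) \<circ> r) g sequentially"
    proof (rule Montel[of S "range (\<lambda>n. F (s (n + N)))" "\<lambda>n. F (s (n + N))"])
      show "\<exists>B. \<forall>h\<in>range (\<lambda>n. F (s (n + N))). \<forall>z\<in>K. norm (h z) \<le> B" if "compact K" "K \<subseteq> S" for K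
        using N(2)[OF sN] that by blast
    qed (use N(1) sN in \<open>auto simp: S_def\<close>)
    have "strict_mono (\<lambda>n. r n + N)" using gr(2) by (auto simp: strict_mono_def)
    moreover have "uniform_limit (cball 0 (real k)) (F \<circ> (s \<circ> (\<lambda>n. r n + N))) g sequentially"
      using gr(3)[of "cball 0 (real k)"] by (simp add: S_def o_def subset_iff)
    ultimately show "\<exists>r'. strict_mono r' \<and> P k (s \<circ> r')" unfolding P_def by blast
  qed
  have stable: "P k (s \<circ> r)" if "strict_mono r" "P k s" for r s k
    using that filterlim_compose[OF _ filterlim_subseq[OF that(1)]]
    unfolding P_def o_def by blast
  \<comment> \<open>From index \<open>Suc k\<close> on, the diagonal sequence is a subsequence of
    one with property \<open>P k\<close>; the shift is undone in \<open>f'\<close>.\<close>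
  have "P k (diagseq \<circ> ((+) (Suc k)))" for k by (rule diagseq_holds) (rule stable)
  then have "\<exists>f. uniform_limit (cball 0 (real k)) (\<lambda>n. F (diagseq (Suc k + n))) f sequentially" for k
    by (simp add: P_def o_def)
  then obtain f where f: "\<And>k. uniform_limit (cball 0 (real k)) (\<lambda>n. F (diagseq (Suc k + n))) (f k) sequentially"
    by metis
  have f': "uniform_limit (cball 0 (real k)) (\<lambda>n. F (diagseq n)) (f k) sequentially" for k
    unfolding uniform_limit_sequentially_iff
  proof (intro allI impI)
    fix e :: real assume "0 < e"
    then obtain N where N: "\<And>n x. N \<le> n \<Longrightarrow> x \<in> cball 0 (real k) \<Longrightarrow> dist (F (diagseq (Suc k + n)) x) (f k x) < e"
      using f[of k] unfolding uniform_limit_sequentially_iff by blast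
    show "\<exists>N. \<forall>n\<ge>N. \<forall>x\<in>cball (0::complex) (real k). dist (F (diagseq n) x) (f k x) < e"
    proof (intro exI[of _ "Suc k + N"] allI impI ballI)
      fix n and x :: complex assume "Suc k + N \<le> n" "x \<in> cball 0 (real k)"
      then show "dist (F (diagseq n) x) (f k x) < e" using N[of "n - Suc k" x] by simp
    qed
  qed
  define g where "g z = lim (\<lambda>n. F (diagseq n) z)" for z
  have g: "f k z = g z" if "z \<in> cball 0 (real k)" for k z
    unfolding g_def using tendsto_uniform_limitI[OF f' that] by (rule limI[symmetric])
  have "uniform_limit (cball 0 R) (\<lambda>n. F (diagseq n)) g sequentially" for R
  proof -
    obtain k where k: "R \<le> real k" using real_arch_simple by blast
    have "uniform_limit (cball 0 (real k)) (\<lambda>n. F (diagseq n)) g sequentially"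
      using f'[of k] g[of _ k] by (subst uniform_limit_cong'[of _ _ "\<lambda>n. F (diagseq n)" _ "f k"]) auto
    then show ?thesis by (rule uniform_limit_on_subset) (use k in auto)
  qed
  moreover have "\<forall>\<^sub>F n in sequentially. F (diagseq n) holomorphic_on ball 0 R" for R
    using eventually_compose_filterlim[OF hol filterlim_subseq[OF subseq_diagseq]] .
  ultimately have "tends_entire (\<lambda>n. F (diagseq n)) g" by (auto simp: tends_entire_def)
  then show ?thesis using subseq_diagseq that by blast
qed

subsection \<open>Rescaling\<close>

text \<open>The centre \<open>a\<close> maximises \<open>(3 r / 4 - dist z z0) * sqrt (norm (deriv G z))\<close> over those \<open>z\<close> with
  \<open>(norm (G z))\<^sup>2 \<le> norm (deriv G z)\<close>. Both sides of this condition scale in the same way under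
  \<open>G(z) \<mapsto> \<rho> G(a + \<rho> z)\<close>.\<close>

lemma rescaling_centre:
  fixes G :: "complex \<Rightarrow> complex"
  assumes G: "G holomorphic_on ball z0 r" and z1: "z1 \<in> ball z0 (r / 2)"
    and m: "0 < m" "m \<le> norm (deriv G z1)" and le: "(norm (G z1))\<^sup>2 \<le> norm (deriv G z1)"
  obtains a \<rho> where "a \<in> ball z0 r" "0 < \<rho>" "\<rho> \<le> 4 / sqrt m" "\<rho> * norm (G a) \<le> 1" "\<rho>\<^sup>2 * norm (deriv G a) = 1"
    "\<And>\<zeta>. norm \<zeta> \<le> r / 8 * sqrt m \<Longrightarrow> a + of_real \<rho> * \<zeta> \<in> ball z0 r"
    "\<And>\<zeta>. norm \<zeta> \<le> r / 8 * sqrt m \<Longrightarrow>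
       \<rho>\<^sup>2 * norm (deriv G (a + of_real \<rho> * \<zeta>)) \<le> max 4 ((\<rho> * norm (G (a + of_real \<rho> * \<zeta>)))\<^sup>2)"
proof -
  have r: "0 < r" using z1 by (metis ball_eq_empty empty_iff half_gt_zero_iff not_le)
  \<comment> \<open>The radius lies strictly between r / 2, so that \<open>h z1\<close> is at least
    r / 4, and r, so that the closed disc is a compact subset of the domain.\<close>
  define s where "s = 3 * r / 4"
  define E where "E = {z \<in> cball z0 s. (norm (G z))\<^sup>2 \<le> norm (deriv G z)}"
  define \<mu> where "\<mu> z = sqrt (norm (deriv G z))" for z
  define h where "h z = s - norm (z - z0)" for z
  have sub: "cball z0 s \<subseteq> ball z0 r" using r by (auto simp: s_def)
  have contG: "continuous_on (cball z0 s) G" "continuous_on (cball z0 s) (deriv G)"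
    using G sub by (meson holomorphic_deriv holomorphic_on_imp_continuous_on holomorphic_on_subset open_ball)+
  have "continuous_on (cball z0 s) (\<lambda>z. (norm (G z))\<^sup>2 - norm (deriv G z))"
    using contG by (intro continuous_intros)
  then have "closed (cball z0 s \<inter> (\<lambda>z. (norm (G z))\<^sup>2 - norm (deriv G z)) -` {..0})"
    by (intro continuous_closed_preimage) auto
  also have "cball z0 s \<inter> (\<lambda>z. (norm (G z))\<^sup>2 - norm (deriv G z)) -` {..0} = E" by (auto simp: E_def)
  finally have "compact E"
    by (metis (no_types, lifting) E_def bounded_cball bounded_subset compact_eq_bounded_closed mem_Collect_eq subsetI)
  moreover have z1E: "z1 \<in> E" using z1 le r by (auto simp: E_def s_def dist_norm)
  moreover have "continuous_on E (\<lambda>z. h z * \<mu> z)"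
    unfolding h_def \<mu>_def
    by (intro continuous_intros continuous_on_subset[OF contG(2)]) (auto simp: E_def)
  ultimately obtain a where aE: "a \<in> E" and max: "\<And>z. z \<in> E \<Longrightarrow> h z * \<mu> z \<le> h a * \<mu> a"
    using continuous_attains_sup[of E "\<lambda>z. h z * \<mu> z"] by blast
  have "r / 4 * sqrt m \<le> h z1 * \<mu> z1"
    using z1 m r by (intro mult_mono) (auto simp: h_def s_def \<mu>_def dist_norm norm_minus_commute)
  then have ha: "r / 4 * sqrt m \<le> h a * \<mu> a" using max[OF z1E] by linarith
  have "0 < r / 4 * sqrt m" using r m by simp
  then have "0 < h a * \<mu> a" using ha by linarith
  moreover have "0 \<le> \<mu> a" by (simp add: \<mu>_def)
  ultimately have pos: "0 < \<mu> a" "0 < h a" by (auto simp: zero_less_mult_iff)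
  define \<rho> where "\<rho> = 1 / \<mu> a"
  have \<rho>: "0 < \<rho>" using pos by (simp add: \<rho>_def)
  have "h a \<le> r" using r norm_ge_zero[of "a - z0"] by (simp add: h_def s_def del: norm_ge_zero)
  then have "r * (1 / 4 * sqrt m) \<le> r * \<mu> a" using ha mult_right_mono[of "h a" r "\<mu> a"] pos by linarith
  then have "sqrt m / 4 \<le> \<mu> a" using r by simp
  then have \<rho>le: "\<rho> \<le> 4 / sqrt m" using m pos by (simp add: \<rho>_def field_simps)
  have \<mu>2: "(\<mu> z)\<^sup>2 = norm (deriv G z)" for z by (simp add: \<mu>_def)
  have da: "\<rho>\<^sup>2 * norm (deriv G a) = 1" using pos by (simp add: \<rho>_def \<mu>2[symmetric] power_divide)
  have "(norm (G a))\<^sup>2 \<le> (\<mu> a)\<^sup>2" using aE by (simp add: E_def \<mu>2)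
  then have "norm (G a) \<le> \<mu> a" by (rule power2_le_imp_le) (use pos in simp)
  then have ga: "\<rho> * norm (G a) \<le> 1" using pos by (simp add: \<rho>_def)
  \<comment> \<open>The radius r / 8 * sqrt m is half of the lower bound in \<open>ha\<close>, so
    the displacement is at most h a / 2 and the weight \<open>h\<close> keeps at least half of its
    value.\<close>
  have near: "a + of_real \<rho> * \<zeta> \<in> cball z0 s \<and> h a / 2 \<le> h (a + of_real \<rho> * \<zeta>)"
      if \<zeta>: "norm \<zeta> \<le> r / 8 * sqrt m" for \<zeta>
  proof -
    have "norm (of_real \<rho> * \<zeta>) = norm \<zeta> / \<mu> a" using pos by (simp add: norm_mult norm_divide \<rho>_def)
    also have "\<dots> \<le> (h a * \<mu> a / 2) / \<mu> a" using \<zeta> ha pos by (intro divide_right_mono) auto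
    also have "\<dots> = h a / 2" using pos by simp
    finally have "norm (of_real \<rho> * \<zeta>) \<le> h a / 2" .
    moreover have "norm (a + of_real \<rho> * \<zeta> - z0) \<le> norm (a - z0) + norm (of_real \<rho> * \<zeta>)"
      using norm_triangle_ineq[of "a - z0" "of_real \<rho> * \<zeta>"] by (simp add: algebra_simps)
    ultimately show ?thesis using pos by (simp add: h_def dist_norm norm_minus_commute)
  qed
  show ?thesis
  proof (rule that[of a \<rho>])
    show "a \<in> ball z0 r" using aE sub by (auto simp: E_def)
    fix \<zeta> :: complex assume \<zeta>: "norm \<zeta> \<le> r / 8 * sqrt m"
    define z where "z = a + of_real \<rho> * \<zeta>"
    have z: "z \<in> cball z0 s" "h a / 2 \<le> h z" using near[OF \<zeta>] by (auto simp: z_def)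
    show "a + of_real \<rho> * \<zeta> \<in> ball z0 r" using z sub by (auto simp: z_def)
    show "\<rho>\<^sup>2 * norm (deriv G (a + of_real \<rho> * \<zeta>)) \<le> max 4 ((\<rho> * norm (G (a + of_real \<rho> * \<zeta>)))\<^sup>2)"
    \<comment> \<open>On \<open>E\<close>, maximality gives \<mu> z \<le> 2 \<mu> a, whose square is
      the 4 in the bound. Off \<open>E\<close>, the defining condition fails and |G|^2
      dominates.\<close>
    proof (cases "z \<in> E")
      case True
      have "h a / 2 * \<mu> z \<le> h z * \<mu> z" using z by (intro mult_right_mono) (auto simp: \<mu>_def)
      also have "\<dots> \<le> h a * \<mu> a" by (rule max[OF True])
      finally have "\<mu> z \<le> 2 * \<mu> a" using pos by simp
      then have "\<rho> * \<mu> z \<le> 2" using pos by (simp add: \<rho>_def field_simps)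
      then have "(\<rho> * \<mu> z)\<^sup>2 \<le> 2\<^sup>2" using \<rho> by (intro power_mono) (auto simp: \<mu>_def)
      then show ?thesis by (simp add: power_mult_distrib \<mu>2 z_def)
    next
      case False
      then have "norm (deriv G z) \<le> (norm (G z))\<^sup>2" using z by (auto simp: E_def)
      then have "\<rho>\<^sup>2 * norm (deriv G z) \<le> \<rho>\<^sup>2 * (norm (G z))\<^sup>2" by (intro mult_left_mono) auto
      then show ?thesis by (simp add: power_mult_distrib z_def)
    qed
  qed (use \<rho> \<rho>le ga da in auto)
qed

text \<open>Otherwise a sequence of rescaled functions converges to an entire f with |f' 0| = 1, for
  which \<open>riccati_poly k f\<close> has a zero without vanishing identically. Hurwitz's theorem
  forbids this, as the rescaled Riccati polynomials avoid functions that tend to 0.\<close>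

proposition omitted_function_deriv_bound:
  assumes hol: "\<And>G. G \<in> \<G> \<Longrightarrow> G holomorphic_on ball z0 r" and k: "2 \<le> k" and r: "0 < r"
    and c: "c holomorphic_on ball z0 r" and cb: "\<And>z. z \<in> ball z0 r \<Longrightarrow> norm (c z) \<le> B"
    and omit: "\<And>G z. G \<in> \<G> \<Longrightarrow> z \<in> ball z0 r \<Longrightarrow> riccati_poly k G z \<noteq> c z"
  obtains M where "\<And>G z. G \<in> \<G> \<Longrightarrow> z \<in> ball z0 (r / 2) \<Longrightarrow> norm (G z) \<le> T \<Longrightarrow> norm (deriv G z) \<le> M"
proof (rule ccontr)
  assume "\<not> thesis"
  then have unbounded: "\<exists>G z. G \<in> \<G> \<and> z \<in> ball z0 (r / 2) \<and> norm (G z) \<le> T \<and> M < norm (deriv G z)" for M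
    using that by (meson not_le)
  \<comment> \<open>The summand T^2 forces |G|^2 \<le> |G'| at the chosen point, the entry condition
    of \<open>rescaling_centre\<close>; the summand n drives the scales to 0.\<close>
  define m where "m n = real n + 1 + T\<^sup>2" for n
  have m: "0 < m n" "real n < m n" for n
    unfolding m_def using zero_le_power2[of T] of_nat_0_le_iff[of n, where ?'a = real] by linarith+
  define N where "N n = r / 8 * sqrt (m n)" for n
  define good where "good n G a \<rho> \<longleftrightarrow> G \<in> \<G> \<and> a \<in> ball z0 r \<and> 0 < \<rho> \<and> \<rho> \<le> 4 / sqrt (m n) \<and>
      \<rho> * norm (G a) \<le> 1 \<and> \<rho>\<^sup>2 * norm (deriv G a) = 1 \<and>
    (\<forall>\<zeta>. norm \<zeta> \<le> N n \<longrightarrow> a + of_real \<rho> * \<zeta> \<in> ball z0 r \<and>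
       \<rho>\<^sup>2 * norm (deriv G (a + of_real \<rho> * \<zeta>)) \<le> max 4 ((\<rho> * norm (G (a + of_real \<rho> * \<zeta>)))\<^sup>2))"
    for n and G :: "complex \<Rightarrow> complex" and a and \<rho> :: real
  have "\<exists>G a \<rho>. good n G a \<rho>" for n
  proof -
    obtain G z where G: "G \<in> \<G>" "z \<in> ball z0 (r / 2)" "norm (G z) \<le> T" "m n < norm (deriv G z)"
      using unbounded by blast
    have "(norm (G z))\<^sup>2 \<le> T\<^sup>2" using G by (intro power_mono) auto
    also have "\<dots> \<le> norm (deriv G z)" using G(4) by (simp add: m_def)
    finally have "(norm (G z))\<^sup>2 \<le> norm (deriv G z)" .
    from rescaling_centre[OF hol[OF G(1)] G(2) m(1) less_imp_le[OF G(4)] this]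
    show ?thesis unfolding good_def N_def using G(1) by metis
  qed
  then obtain G a \<rho> where good: "\<And>n. good n (G n) (a n) (\<rho> n)" by metis
  have G: "G n \<in> \<G>" and a: "a n \<in> ball z0 r" and \<rho>: "0 < \<rho> n" "\<rho> n \<le> 4 / sqrt (m n)"
    and Ga: "\<rho> n * norm (G n (a n)) \<le> 1" and dGa: "(\<rho> n)\<^sup>2 * norm (deriv (G n) (a n)) = 1" for n
    using good[of n] by (auto simp: good_def)
  have dom: "a n + of_real (\<rho> n) * \<zeta> \<in> ball z0 r" if "norm \<zeta> \<le> N n" for n \<zeta>
    using good[of n] that by (auto simp: good_def)
  have growth: "(\<rho> n)\<^sup>2 * norm (deriv (G n) (a n + of_real (\<rho> n) * \<zeta>)) \<le> max 4 ((\<rho> n * norm (G n (a n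
      + of_real (\<rho> n) * \<zeta>)))\<^sup>2)"
    if "norm \<zeta> \<le> N n" for n \<zeta>
    using good[of n] that by (auto simp: good_def)
  have m_top: "filterlim m at_top sequentially"
    by (rule filterlim_at_top_mono[OF filterlim_real_sequentially]) (use m in \<open>auto intro!: always_eventually less_imp_le\<close>)
  then have sqrt_top: "filterlim (\<lambda>n. sqrt (m n)) at_top sequentially"
    by (rule filterlim_compose[OF sqrt_at_top])
  have N_top: "\<forall>\<^sub>F n in sequentially. R \<le> N n" for R
  proof -
    have "filterlim N at_top sequentially" unfolding N_def
      using r by (intro filterlim_tendsto_pos_mult_at_top[OF tendsto_const _ sqrt_top]) auto
    then show ?thesis by (auto simp: filterlim_at_top)
  qed
  have \<rho>0: "\<rho> \<longlonglongrightarrow> 0"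
  proof (rule tendsto_sandwich[of "\<lambda>_. 0"])
    show "(\<lambda>n. 4 / sqrt (m n)) \<longlonglongrightarrow> 0"
      by (rule tendsto_divide_0[OF tendsto_const filterlim_at_top_imp_at_infinity[OF sqrt_top]])
  qed (use \<rho> in \<open>auto intro!: always_eventually less_imp_le\<close>)
  define F where "F n \<zeta> = of_real (\<rho> n) * G n (a n + of_real (\<rho> n) * \<zeta>)" for n \<zeta>
  have compose: "(\<lambda>\<zeta>. h (a n + of_real (\<rho> n) * \<zeta>)) holomorphic_on ball 0 R"
    if "h holomorphic_on ball z0 r" "R \<le> N n" for h n R
    using that dom[of _ n]
    by (intro holomorphic_on_compose_gen[OF _ that(1), unfolded o_def] holomorphic_intros) auto
  have Fhol: "F n holomorphic_on ball 0 R" if "R \<le> N n" for n R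
    unfolding F_def[abs_def] by (intro holomorphic_intros compose hol G that)
  have dF: "deriv (F n) \<zeta> = of_real ((\<rho> n)\<^sup>2) * deriv (G n) (a n + of_real (\<rho> n) * \<zeta>)" if "norm \<zeta> \<le> N n" for n \<zeta>
  proof -
    have "(G n has_field_derivative deriv (G n) (a n + of_real (\<rho> n) * \<zeta>)) (at (a n + of_real (\<rho> n) * \<zeta>))"
      by (rule holomorphic_derivI[OF hol[OF G] open_ball dom[OF that]])
    moreover have "((\<lambda>\<zeta>. a n + of_real (\<rho> n) * \<zeta>) has_field_derivative of_real (\<rho> n)) (at \<zeta>)"
      by (auto intro!: derivative_eq_intros)
    ultimately have "((\<lambda>\<zeta>. G n (a n + of_real (\<rho> n) * \<zeta>)) has_field_derivative deriv (G n) (a n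
        + of_real (\<rho> n) * \<zeta>) * of_real (\<rho> n)) (at \<zeta>)"
      by (rule DERIV_chain2)
    then have "(F n has_field_derivative of_real (\<rho> n) * (deriv (G n) (a n
        + of_real (\<rho> n) * \<zeta>) * of_real (\<rho> n))) (at \<zeta>)"
      unfolding F_def[abs_def] by (rule DERIV_cmult)
    then show ?thesis by (simp add: DERIV_imp_deriv power2_eq_square)
  qed
  have nF: "norm (F n \<zeta>) = \<rho> n * norm (G n (a n + of_real (\<rho> n) * \<zeta>))" for n \<zeta>
    using \<rho>(1)[of n] by (simp add: F_def norm_mult)
  have ndF: "norm (deriv (F n) \<zeta>) = (\<rho> n)\<^sup>2 * norm (deriv (G n) (a n + of_real (\<rho> n) * \<zeta>))"
      if "norm \<zeta> \<le> N n" for n \<zeta>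
    unfolding dF[OF that] norm_mult norm_of_real by simp
  have Fgrowth: "norm (deriv (F n) \<zeta>) \<le> max 4 ((norm (F n \<zeta>))\<^sup>2)" if "norm \<zeta> \<le> N n" for n \<zeta>
    unfolding nF ndF[OF that] by (rule growth[OF that])
  \<comment> \<open>\<open>slow_growth\<close> is used with centre \<zeta>, the point 0 and M = 4,
    the growth bound where |F n| \<le> 1. The ball involved lies within 2 |\<zeta>| + 1 of the
    origin.\<close>
  have Fexp: "norm (F n \<zeta>) \<le> exp (8 * norm \<zeta>)" if \<zeta>: "2 * norm \<zeta> + 1 \<le> N n" for n \<zeta>
  proof -
    have sub: "norm x \<le> N n" if "x \<in> ball \<zeta> (norm \<zeta> + 1)" for x
      using that \<zeta> norm_triangle_ineq2[of x \<zeta>] by (simp add: dist_norm norm_minus_commute)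
    then have "ball \<zeta> (norm \<zeta> + 1) \<subseteq> ball 0 (2 * norm \<zeta> + 1)"
      using norm_triangle_ineq2 by (auto simp: dist_norm norm_minus_commute) (smt (verit) norm_triangle_ineq2)
    then have "F n holomorphic_on ball \<zeta> (norm \<zeta> + 1)"
      using Fhol[OF \<zeta>] by (rule holomorphic_on_subset[rotated])
    moreover have "norm (deriv (F n) x) \<le> 4" if "x \<in> ball \<zeta> (norm \<zeta> + 1)" "norm (F n x) \<le> 1" for x
    proof -
      have "(norm (F n x))\<^sup>2 \<le> 1\<^sup>2" using that by (intro power_mono) auto
      then show ?thesis using Fgrowth[OF sub[OF that(1)]] by simp
    qed
    moreover have "norm (F n 0) \<le> 1" using Ga[of n] by (simp add: nF)
    ultimately have "norm (F n \<zeta>) \<le> exp (2 * 4 * norm (\<zeta> - 0))"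
      by (intro slow_growth[of _ _ "norm \<zeta> + 1"]) auto
    then show ?thesis by simp
  qed
  have "\<exists>B. \<forall>\<^sub>F n in sequentially. \<forall>z\<in>ball 0 R. norm (F n z) \<le> B" for R
  proof (rule exI[of _ "exp (8 * R)"])
    show "\<forall>\<^sub>F n in sequentially. \<forall>z\<in>ball 0 R. norm (F n z) \<le> exp (8 * R)"
      using N_top[of "2 * R + 1"]
    proof eventually_elim
      case (elim n)
      show ?case
      proof
        fix z :: complex assume "z \<in> ball 0 R"
        then have "norm (F n z) \<le> exp (8 * norm z)" "exp (8 * norm z) \<le> exp (8 * R)"
          using elim by (auto intro!: Fexp)
        then show "norm (F n z) \<le> exp (8 * R)" by linarith
      qed
    qed
  qed
  moreover have "\<forall>\<^sub>F n in sequentially. F n holomorphic_on ball 0 R" for R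
    using N_top[of R] by eventually_elim (rule Fhol)
  ultimately obtain f s where s: "strict_mono s" and f: "tends_entire (\<lambda>n. F (s n)) f"
    using Montel_entire[of F] by blast
  have s_lim: "filterlim s sequentially sequentially" using s by (rule filterlim_subseq)
  have hf: "f holomorphic_on UNIV" using f by (rule tends_entire_holomorphic)
  have lim: "(\<lambda>n. F (s n) z) \<longlonglongrightarrow> f z" "(\<lambda>n. deriv (F (s n)) z) \<longlonglongrightarrow> deriv f z" for z
    using tends_entire_pointwise[OF f] tends_entire_pointwise[OF tends_entire_deriv[OF f]] by auto
  have sN: "\<forall>\<^sub>F n in sequentially. R \<le> N (s n)" for R
    using eventually_compose_filterlim[OF N_top s_lim] .
  have fgrowth: "norm (deriv f z) \<le> max 4 ((norm (f z))\<^sup>2)" for z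
  proof (rule tendsto_le[OF sequentially_bot])
    show "(\<lambda>n. max 4 ((norm (F (s n) z))\<^sup>2)) \<longlonglongrightarrow> max 4 ((norm (f z))\<^sup>2)"
      by (intro tendsto_intros lim)
    show "(\<lambda>n. norm (deriv (F (s n)) z)) \<longlonglongrightarrow> norm (deriv f z)" by (intro tendsto_intros lim)
    show "\<forall>\<^sub>F n in sequentially. norm (deriv (F (s n)) z) \<le> max 4 ((norm (F (s n) z))\<^sup>2)"
      using sN[of "norm z"] by eventually_elim (rule Fgrowth)
  qed
  have "exponential_type f"
  proof (rule exponential_typeI[of 1 8])
    fix z
    show "norm (f z) \<le> 1 * exp (8 * norm z)"
    proof (rule tendsto_upperbound[OF tendsto_norm[OF lim(1)] _ sequentially_bot])
      show "\<forall>\<^sub>F n in sequentially. norm (F (s n) z) \<le> 1 * exp (8 * norm z)"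
        using sN[of "2 * norm z + 1"] by eventually_elim (simp add: Fexp)
    qed
  qed auto
  moreover have "deriv f 0 \<noteq> 0"
  proof -
    have "0 \<le> N n" for n using r m(1)[of n] by (simp add: N_def)
    then have "norm (deriv (F (s n)) 0) = 1" for n by (subst ndF) (auto simp: dGa)
    then have "(\<lambda>n. 1) \<longlonglongrightarrow> norm (deriv f 0)" using tendsto_norm[OF lim(2)[of 0]] by simp
    then have "norm (deriv f 0) = 1" by (simp add: LIMSEQ_const_iff)
    then show ?thesis by auto
  qed
  ultimately obtain z w where zw: "riccati_poly k f z = 0" "riccati_poly k f w \<noteq> 0"
    using riccati_poly_has_zero[OF hf fgrowth _ _ k] riccati_poly_nonzero[OF hf fgrowth] by blast
  define C where "C n \<zeta> = of_real (\<rho> n) ^ k * c (a n + of_real (\<rho> n) * \<zeta>)" for n \<zeta>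
  have "tends_entire C (\<lambda>_. 0)"
    unfolding tends_entire_def
  proof (intro conjI allI)
    fix R
    show "\<forall>\<^sub>F n in sequentially. C n holomorphic_on ball 0 R"
      using N_top[of R] unfolding C_def[abs_def] by eventually_elim (intro holomorphic_intros compose c)
    have B0: "0 \<le> B" using cb[of z0] r by (auto intro: order_trans[OF norm_ge_zero])
    have lim0: "(\<lambda>n. \<rho> n ^ k * B) \<longlonglongrightarrow> 0"
    proof -
      have "0 ^ k * B = 0" using k by (simp add: zero_power)
      then show ?thesis using tendsto_mult[OF tendsto_power[OF \<rho>0, of k] tendsto_const[of B]] by metis
    qed
    show "uniform_limit (cball 0 R) C (\<lambda>_. 0) sequentially"
    proof (rule uniform_limitI)
      fix e :: real assume "0 < e"
      then have "\<forall>\<^sub>F n in sequentially. \<rho> n ^ k * B < e"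
        using order_tendstoD(2)[OF lim0] by blast
      then show "\<forall>\<^sub>F n in sequentially. \<forall>x\<in>cball 0 R. dist (C n x) 0 < e"
        using N_top[of R]
      proof eventually_elim
        case (elim n)
        show ?case
        proof
          fix x :: complex assume "x \<in> cball 0 R"
          then have "norm (c (a n + of_real (\<rho> n) * x)) \<le> B" using elim by (intro cb dom) auto
          then have "norm (C n x) \<le> \<rho> n ^ k * B" using \<rho>(1)[of n]
            by (auto simp: C_def norm_mult norm_power intro!: mult_left_mono)
          then show "dist (C n x) 0 < e" using elim by simp
        qed
      qed
    qed
  qed
  then have "tends_entire (\<lambda>n. C (s n)) (\<lambda>_. 0)" by (rule tends_entire_subseq[OF _ s])
  then have H: "tends_entire (\<lambda>n \<zeta>. riccati_poly k (F (s n)) \<zeta> - C (s n) \<zeta>) (\<lambda>\<zeta>. riccati_poly k f \<zeta> - 0)"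
    by (intro tends_entire_diff tends_entire_riccati_poly f)
  have "riccati_poly k f z - 0 \<noteq> 0"
  proof (rule tends_entire_Hurwitz[OF H])
    fix R
    show "\<forall>\<^sub>F n in sequentially. \<forall>z\<in>ball 0 R. riccati_poly k (F (s n)) z - C (s n) z \<noteq> 0"
      using sN[of R]
    proof eventually_elim
      case (elim n)
      show ?case
      proof
        fix \<zeta> :: complex assume "\<zeta> \<in> ball 0 R"
        then have d: "a (s n) + of_real (\<rho> (s n)) * \<zeta> \<in> ball z0 r" using elim by (intro dom) auto
        have "riccati_poly k (F (s n)) \<zeta> - C (s n) \<zeta>
            = of_real (\<rho> (s n)) ^ k * (riccati_poly k (G (s n)) (a (s n) + of_real (\<rho> (s n)) * \<zeta>) - c (a (s n) + of_real (\<rho> (s n)) * \<zeta>))"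
          unfolding F_def[abs_def] C_def
          by (subst riccati_poly_rescale[OF open_ball hol[OF G] d]) (simp add: algebra_simps)
        then show "riccati_poly k (F (s n)) \<zeta> - C (s n) \<zeta> \<noteq> 0"
          using \<rho>(1)[of "s n"] omit[OF G d] by simp
      qed
    qed
    show "riccati_poly k f w - 0 \<noteq> 0" using zw by simp
  qed
  then show False using zw by simp
qed

subsection \<open>Local control of a family\<close>

text \<open>\<open>K\<close> depends on \<open>T\<close> but not on the member \<open>g\<close>.
  Read backwards, the condition says that members huge somewhere on \<open>B\<close> are large
  throughout \<open>A\<close>, so it handles bounded sequences and sequences tending to infinity at
  once.\<close>

definition controls :: "(complex \<Rightarrow> complex) set \<Rightarrow> complex set \<Rightarrow> complex set \<Rightarrow> bool" where
  "controls \<G> A B \<longleftrightarrow> (\<forall>T. \<exists>K. \<forall>g\<in>\<G>. (\<exists>w\<in>A. norm (g w) \<le> T) \<longrightarrow> (\<forall>x\<in>B. norm (g x) \<le> K))"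

definition locally_controlled_at :: "(complex \<Rightarrow> complex) set \<Rightarrow> complex \<Rightarrow> bool" where
  "locally_controlled_at \<G> z \<longleftrightarrow> (\<exists>U. open U \<and> z \<in> U \<and> controls \<G> U U)"

lemma controlsE:
  assumes "controls \<G> A B"
  obtains K where "\<And>g w x. g \<in> \<G> \<Longrightarrow> w \<in> A \<Longrightarrow> norm (g w) \<le> T \<Longrightarrow> x \<in> B \<Longrightarrow> norm (g x) \<le> K"
  using assms unfolding controls_def by metis

lemma controlsI:
  assumes "\<And>T. \<exists>K. \<forall>g w x. g \<in> \<G> \<longrightarrow> w \<in> A \<longrightarrow> norm (g w) \<le> T \<longrightarrow> x \<in> B \<longrightarrow> norm (g x) \<le> K"
  shows "controls \<G> A B"
  using assms unfolding controls_def by metis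

lemma controls_mono: "controls \<G> A B \<Longrightarrow> A' \<subseteq> A \<Longrightarrow> B' \<subseteq> B \<Longrightarrow> controls \<G> A' B'"
  unfolding controls_def by (meson subsetD)

lemma controls_trans:
  assumes "controls \<G> A B" "controls \<G> B C" "b \<in> B"
  shows "controls \<G> A C"
proof (rule controlsI)
  fix T
  obtain K where K: "\<And>g w x. g \<in> \<G> \<Longrightarrow> w \<in> A \<Longrightarrow> norm (g w) \<le> T \<Longrightarrow> x \<in> B \<Longrightarrow> norm (g x) \<le> K"
    using controlsE[OF assms(1), of T] by metis
  obtain L where L: "\<And>g w x. g \<in> \<G> \<Longrightarrow> w \<in> B \<Longrightarrow> norm (g w) \<le> K \<Longrightarrow> x \<in> C \<Longrightarrow> norm (g x) \<le> L"
    using controlsE[OF assms(2), of K] by metis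
  show "\<exists>K. \<forall>g w x. g \<in> \<G> \<longrightarrow> w \<in> A \<longrightarrow> norm (g w) \<le> T \<longrightarrow> x \<in> C \<longrightarrow> norm (g x) \<le> K"
    using K L assms(3) by blast
qed

lemma controls_Union_left:
  assumes "finite I" "\<And>i. i \<in> I \<Longrightarrow> controls \<G> (A i) B"
  shows "controls \<G> (\<Union>i\<in>I. A i) B"
  using assms
proof (induction I rule: finite_induct)
  case (insert i I)
  show ?case
  proof (rule controlsI)
    fix T
    obtain K where K: "\<And>g w x. g \<in> \<G> \<Longrightarrow> w \<in> A i \<Longrightarrow> norm (g w) \<le> T \<Longrightarrow> x \<in> B \<Longrightarrow> norm (g x) \<le> K"
      using controlsE[OF insert.prems[of i], of T] by auto
    have "controls \<G> (\<Union>i\<in>I. A i) B" using insert by auto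
    then obtain L where L: "\<And>g w x. g \<in> \<G> \<Longrightarrow> w \<in> (\<Union>i\<in>I. A i) \<Longrightarrow> norm (g w) \<le> T \<Longrightarrow> x \<in> B \<Longrightarrow> norm (g x) \<le> L"
      using controlsE[of \<G> "\<Union>i\<in>I. A i" B T] by metis
    show "\<exists>K. \<forall>g w x. g \<in> \<G> \<longrightarrow> w \<in> (\<Union>i\<in>insert i I. A i) \<longrightarrow> norm (g w) \<le> T \<longrightarrow> x \<in> B \<longrightarrow> norm (g x) \<le> K"
    proof (intro exI[of _ "max K L"] allI impI)
      fix g w x assume "g \<in> \<G>" "w \<in> (\<Union>i\<in>insert i I. A i)" "norm (g w) \<le> T" "x \<in> B"
      then show "norm (g x) \<le> max K L" using K[of g w x] L[of g w x]
        by (simp only: UN_insert Un_iff le_max_iff_disj) blast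
    qed
  qed
qed (simp add: controls_def)

lemma controls_Union_right:
  assumes "finite I" "\<And>i. i \<in> I \<Longrightarrow> controls \<G> A (B i)"
  shows "controls \<G> A (\<Union>i\<in>I. B i)"
  using assms
proof (induction I rule: finite_induct)
  case (insert i I)
  show ?case
  proof (rule controlsI)
    fix T
    obtain K where K: "\<And>g w x. g \<in> \<G> \<Longrightarrow> w \<in> A \<Longrightarrow> norm (g w) \<le> T \<Longrightarrow> x \<in> B i \<Longrightarrow> norm (g x) \<le> K"
      using controlsE[OF insert.prems[of i], of T] by auto
    have "controls \<G> A (\<Union>i\<in>I. B i)" using insert by auto
    then obtain L where L: "\<And>g w x. g \<in> \<G> \<Longrightarrow> w \<in> A \<Longrightarrow> norm (g w) \<le> T \<Longrightarrow> x \<in> (\<Union>i\<in>I. B i) \<Longrightarrow> norm (g x) \<le> L"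
      using controlsE[of \<G> A "\<Union>i\<in>I. B i" T] by metis
    show "\<exists>K. \<forall>g w x. g \<in> \<G> \<longrightarrow> w \<in> A \<longrightarrow> norm (g w) \<le> T \<longrightarrow> x \<in> (\<Union>i\<in>insert i I. B i) \<longrightarrow> norm (g x) \<le> K"
    proof (intro exI[of _ "max K L"] allI impI)
      fix g w x assume "g \<in> \<G>" "w \<in> A" "norm (g w) \<le> T" "x \<in> (\<Union>i\<in>insert i I. B i)"
      then show "norm (g x) \<le> max K L" using K[of g w x] L[of g w x]
        by (simp only: UN_insert Un_iff le_max_iff_disj) blast
    qed
  qed
qed (simp add: controls_def)

text \<open>Mutual control of single points is an equivalence relation that holds locally, so
  connectedness extends it to all pairs in V. A finite cover of C then links any two of its sets
  through their centres.\<close>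

lemma controls_compact:
  assumes V: "connected V" and loc: "\<And>z. z \<in> V \<Longrightarrow> locally_controlled_at \<G> z"
    and C: "compact C" "C \<subseteq> V"
  shows "controls \<G> C C"
proof -
  obtain U where U: "\<And>z. z \<in> V \<Longrightarrow> open (U z)" "\<And>z. z \<in> V \<Longrightarrow> z \<in> U z" "\<And>z. z \<in> V \<Longrightarrow> controls \<G> (U z) (U z)"
    using loc unfolding locally_controlled_at_def by metis
  have pts: "controls \<G> {a} {b} \<and> controls \<G> {b} {a}" if "a \<in> V" "b \<in> V" for a b
    using V that
  proof (rule connected_equivalence_relation)
    fix x y z assume "controls \<G> {x} {y} \<and> controls \<G> {y} {x}" "controls \<G> {y} {z} \<and> controls \<G> {z} {y}"
    then show "controls \<G> {x} {z} \<and> controls \<G> {z} {x}"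
      using controls_trans[of \<G> "{x}" "{y}" "{z}" y] controls_trans[of \<G> "{z}" "{y}" "{x}" y] by auto
  next
    fix a assume a: "a \<in> V"
    show "\<exists>T. openin (top_of_set V) T \<and> a \<in> T \<and> (\<forall>x\<in>T. controls \<G> {a} {x} \<and> controls \<G> {x} {a})"
    proof (intro exI[of _ "V \<inter> U a"] conjI ballI)
      show "openin (top_of_set V) (V \<inter> U a)" using U(1)[OF a] by (rule openin_open_Int)
      fix x assume "x \<in> V \<inter> U a"
      then show "controls \<G> {a} {x}" "controls \<G> {x} {a}"
        using U(2)[OF a] by (auto intro: controls_mono[OF U(3)[OF a]])
    qed (use a U in auto)
  qed blast
  obtain D where D: "D \<subseteq> C" "finite D" "C \<subseteq> (\<Union>z\<in>D. U z)"
  proof (rule compactE_image[OF C(1), of C U])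
    show "C \<subseteq> (\<Union>z\<in>C. U z)" using U(2) C(2) by blast
  qed (use U(1) C(2) in auto)
  have "controls \<G> (U a) (U b)" if "a \<in> D" "b \<in> D" for a b
  proof -
    have ab: "a \<in> V" "b \<in> V" using that D C by auto
    have "controls \<G> (U a) {a}" "controls \<G> {b} (U b)"
      using controls_mono[OF U(3)[OF ab(1)], of "U a" "{a}"] controls_mono[OF U(3)[OF ab(2)], of "{b}" "U b"] U(2) ab by auto
    then show ?thesis using pts[OF ab] controls_trans[of \<G> "U a" "{a}" "{b}" a] controls_trans[of \<G> "U a" "{b}" "U b" b] by auto
  qed
  then have "controls \<G> (\<Union>z\<in>D. U z) (\<Union>z\<in>D. U z)"
    using D(2) by (intro controls_Union_left controls_Union_right) auto
  then show ?thesis by (rule controls_mono) (use D in auto)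
qed

text \<open>\<open>omitted_function_deriv_bound\<close> bounds the derivative only where the
  function itself is bounded, which is just what \<open>slow_growth\<close> asks for after division
  by that bound.\<close>

lemma omitted_holomorphic_locally_controlled:
  assumes hol: "\<And>G. G \<in> \<G> \<Longrightarrow> G holomorphic_on S" and S: "open S" "z0 \<in> S" and k: "2 \<le> k"
    and c: "c holomorphic_on S" 
    and omit: "\<And>G z. G \<in> \<G> \<Longrightarrow> z \<in> S \<Longrightarrow> riccati_poly k G z \<noteq> c z"
  shows "locally_controlled_at \<G> z0"
proof -
  obtain r where r: "0 < r" "cball z0 r \<subseteq> S" using S open_contains_cball_eq by blast
  have bS: "ball z0 r \<subseteq> S" using r by auto
  have "continuous_on (cball z0 r) c"
    using c r by (meson holomorphic_on_imp_continuous_on holomorphic_on_subset)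
  then have "bounded (c ` cball z0 r)" by (intro compact_imp_bounded compact_continuous_image) auto
  then obtain B where B: "\<And>z. z \<in> cball z0 r \<Longrightarrow> norm (c z) \<le> B" unfolding bounded_iff by blast
  \<comment> \<open>Two points of this ball are less than r / 3 apart, and 1 / 6 + 1 / 3 = 1 / 2
    keeps the ball of radius r / 3 around either of them inside the region of the derivative
    bound.\<close>
  have "controls \<G> (ball z0 (r / 6)) (ball z0 (r / 6))"
  proof (rule controlsI)
    fix T :: real
    define T' where "T' = max T 1"
    have T': "0 < T'" "T \<le> T'" by (auto simp: T'_def)
    obtain M where M: "\<And>G z. G \<in> \<G> \<Longrightarrow> z \<in> ball z0 (r / 2) \<Longrightarrow> norm (G z) \<le> T' \<Longrightarrow> norm (deriv G z) \<le> M"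
    proof (rule omitted_function_deriv_bound[of \<G> z0 r k c B T'])
      show "G holomorphic_on ball z0 r" if "G \<in> \<G>" for G using hol[OF that] bS by (rule holomorphic_on_subset)
      show "c holomorphic_on ball z0 r" using c bS by (rule holomorphic_on_subset)
    qed (use k r B omit bS in auto)
    show "\<exists>K. \<forall>g w x. g \<in> \<G> \<longrightarrow> w \<in> ball z0 (r / 6) \<longrightarrow> norm (g w) \<le> T \<longrightarrow> x \<in> ball z0 (r / 6) \<longrightarrow> norm (g x) \<le> K"
    proof (intro exI[of _ "T' * exp (2 * (\<bar>M\<bar> / T') * r)"] allI impI)
      fix g w x assume g: "g \<in> \<G>" and w: "w \<in> ball z0 (r / 6)" and gw: "norm (g w) \<le> T"
          and x: "x \<in> ball z0 (r / 6)"
      define f where "f = (\<lambda>z. g z / of_real T')"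
      have sub: "ball x (r / 3) \<subseteq> ball z0 (r / 2)"
      proof
        fix y assume "y \<in> ball x (r / 3)"
        then show "y \<in> ball z0 (r / 2)" using x dist_triangle[of z0 y x] by simp
      qed
      have wx: "dist x w < r / 3" using w x dist_triangle[of x w z0] by (simp add: dist_commute)
      have hg: "g holomorphic_on ball z0 r" using hol[OF g] bS by (rule holomorphic_on_subset)
      have nf: "norm (f y) = norm (g y) / T'" for y using T' by (simp add: f_def norm_divide)
      have "norm (f x) \<le> exp (2 * (\<bar>M\<bar> / T') * norm (x - w))"
      proof (rule slow_growth)
        have "ball x (r / 3) \<subseteq> ball z0 r" using sub r by (auto intro: order_trans)
        then show "f holomorphic_on ball x (r / 3)" unfolding f_def
          using T' by (intro holomorphic_intros holomorphic_on_subset[OF hg]) auto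
        show "w \<in> ball x (r / 3)" using wx by simp
        show "norm (f w) \<le> 1" using gw T' by (simp add: nf field_simps)
        fix y assume y: "y \<in> ball x (r / 3)" "norm (f y) \<le> 1"
        have yr: "y \<in> ball z0 (r / 2)" using y sub by auto
        then have "y \<in> ball z0 r" using r by auto
        then have "(g has_field_derivative deriv g y) (at y)" by (rule holomorphic_derivI[OF hg open_ball])
        then have "deriv f y = deriv g y / of_real T'"
          unfolding f_def by (intro DERIV_imp_deriv DERIV_cdivide)
        moreover have "norm (deriv g y) \<le> M" by (rule M[OF g yr]) (use y T' in \<open>simp add: nf field_simps\<close>)
        ultimately show "norm (deriv f y) \<le> \<bar>M\<bar> / T'" using T' by (simp add: norm_divide divide_right_mono)
      qed
      also have "\<dots> \<le> exp (2 * (\<bar>M\<bar> / T') * r)"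
      proof -
        have "norm (x - w) \<le> r" using wx r by (simp add: dist_norm)
        then show ?thesis using T' by (simp add: mult_left_mono divide_right_mono)
      qed
      finally show "norm (g x) \<le> T' * exp (2 * (\<bar>M\<bar> / T') * r)"
        using T' by (simp add: nf field_simps)
    qed
  qed
  then show ?thesis unfolding locally_controlled_at_def using r
    by (intro exI[of _ "ball z0 (r / 6)"]) auto
qed

text \<open>At a pole of the omitted function the members of \<open>\<G>\<close> cannot be large on a surrounding circle:
  otherwise \<open>1 / (\<delta> * riccati_poly k G - 1)\<close> would be small on the circle, but it is \<open>-1\<close> at the centre.\<close>

lemma omitted_pole_locally_controlled:
  assumes hol: "\<And>G. G \<in> \<G> \<Longrightarrow> G holomorphic_on ball z0 r" and r: "0 < r" and k: "2 \<le> k"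
    and \<delta>: "\<delta> holomorphic_on ball z0 r" "\<delta> z0 = 0" and \<delta>nz: "\<And>z. z \<in> ball z0 r - {z0} \<Longrightarrow> \<delta> z \<noteq> 0"
    and omit: "\<And>G z. G \<in> \<G> \<Longrightarrow> z \<in> ball z0 r \<Longrightarrow> \<delta> z * riccati_poly k G z \<noteq> 1"
  shows "locally_controlled_at \<G> z0"
proof -
  define V where "V = ball z0 r - {z0}"
  \<comment> \<open>The annulus contains the ball of radius r / 4 around each point of its middle
    circle, where the cofactor bound will be used, and it is compact in the punctured disc, where 1
    / \<delta> is holomorphic.\<close>
  define C where "C = cball z0 (3 * r / 4) - ball z0 (r / 4)"
  have "locally_controlled_at \<G> z" if z: "z \<in> V" for z
  proof (rule omitted_holomorphic_locally_controlled[of \<G> V z k "\<lambda>z. inverse (\<delta> z)"])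
    show "open V" by (auto simp: V_def)
    show "G holomorphic_on V" if "G \<in> \<G>"
        for G using hol[OF that] by (rule holomorphic_on_subset) (auto simp: V_def)
    show "(\<lambda>z. inverse (\<delta> z)) holomorphic_on V"
      using \<delta>nz by (intro holomorphic_intros holomorphic_on_subset[OF \<delta>(1)]) (auto simp: V_def)
    show "riccati_poly k G z \<noteq> inverse (\<delta> z)" if "G \<in> \<G>" "z \<in> V" for G z
      using omit[OF that(1), of z] \<delta>nz[of z] that(2) by (auto simp: V_def)
  qed (use z k in auto)
  moreover have "connected V" unfolding V_def
    by (intro connected_open_delete) auto
  moreover have "compact C" unfolding C_def by (intro compact_diff) auto
  moreover have "C \<subseteq> V" using r by (auto simp: C_def V_def)
  ultimately have CC: "controls \<G> C C" by (intro controls_compact[of V]) auto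
  define s where "s = sphere z0 (r / 2)"
  have sC: "s \<subseteq> C" using r by (auto simp: s_def C_def)
  have sV: "s \<subseteq> ball z0 r - {z0}" using r by (auto simp: s_def)
  have nearC: "ball x (r / 4) \<subseteq> C" if "x \<in> s" for x
  proof
    fix y assume "y \<in> ball x (r / 4)"
    then show "y \<in> C" using that dist_triangle[of z0 y x] dist_triangle[of z0 x y] by (auto simp: s_def C_def dist_commute)
  qed
  have "compact s" "s \<noteq> {}" using r by (auto simp: s_def)
  moreover have "continuous_on s (\<lambda>z. norm (\<delta> z))"
    using sV by (intro continuous_intros holomorphic_on_imp_continuous_on holomorphic_on_subset[OF \<delta>(1)]) auto
  ultimately obtain x0 where x0: "x0 \<in> s" "\<And>x. x \<in> s \<Longrightarrow> norm (\<delta> x0) \<le> norm (\<delta> x)"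
    using continuous_attains_inf by metis
  have max_mod: "norm (h x) \<le> B"
    if h: "h holomorphic_on ball z0 r" and B: "\<And>z. z \<in> s \<Longrightarrow>
        norm (h z) \<le> B" and x: "x \<in> ball z0 (r / 2)" for h x B
  proof (rule maximum_modulus_frontier[of h "ball z0 (r / 2)"])
    have sub: "ball z0 (r / 2) \<subseteq> ball z0 r" "cball z0 (r / 2) \<subseteq> ball z0 r" using r by auto
    show "h holomorphic_on interior (ball z0 (r / 2))"
      using h sub by (auto intro: holomorphic_on_subset)
    show "continuous_on (closure (ball z0 (r / 2))) h"
      using holomorphic_on_imp_continuous_on[OF holomorphic_on_subset[OF h sub(2)]] r by simp
    show "norm (h z) \<le> B" if "z \<in> frontier (ball z0 (r / 2))" for z
      using that r by (intro B) (auto simp: s_def)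
  qed (use x in auto)
  define d where "d = norm (\<delta> x0)"
  have d: "0 < d" "\<And>x. x \<in> s \<Longrightarrow> d \<le> norm (\<delta> x)" using x0 \<delta>nz[of x0] subsetD[OF sV x0(1)] by (simp_all add: d_def)
  have r4: "0 < r / 4" using r by simp
  obtain B where B: "0 \<le> B" and bound: "\<And>u w \<epsilon> x. u holomorphic_on ball w (r / 4) \<Longrightarrow> \<epsilon> \<le> 1 \<Longrightarrow>
     (\<forall>x\<in>ball w (r / 4). norm (u x) \<le> \<epsilon>) \<Longrightarrow> x \<in> ball w (r / 4 / 2 ^ k) \<Longrightarrow> norm (riccati_cofactor k u x - 1) \<le> B * \<epsilon>"
    using riccati_cofactor_bound[OF r4, of k] by auto
  \<comment> \<open>The summand 2 * B gives cofactors of modulus at least 1 / 2 on the circle, and 6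
    / d then makes |\<delta> * riccati_poly k G| at least d T / 2 \<ge> 3.\<close>
  define T where "T = 1 + 2 * B + 6 / d"
  have T: "1 \<le> T" "B * (1 / T) \<le> 1 / 2" "6 \<le> d * T"
    using B d(1) by (auto simp: T_def field_simps add_nonneg_pos add_pos_nonneg)
  obtain K where K: "\<And>g w x. g \<in> \<G> \<Longrightarrow> w \<in> C \<Longrightarrow> norm (g w) \<le> T \<Longrightarrow> x \<in> C \<Longrightarrow> norm (g x) \<le> K"
    using controlsE[OF CC, of T] by metis
  have small_somewhere: "\<exists>w\<in>C. norm (G w) \<le> T" if G: "G \<in> \<G>" for G
  proof (rule ccontr)
    assume "\<not> ?thesis"
    then have big: "T < norm (G w)" if "w \<in> C" for w using that by (meson not_le)
    define \<Phi> where "\<Phi> = (\<lambda>z. 1 / (\<delta> z * riccati_poly k G z - 1))"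
    have \<Phi>s: "norm (\<Phi> x) \<le> 1 / 2" if x: "x \<in> s" for x
    proof -
      let ?u = "\<lambda>z. inverse (G z)"
      have subr: "ball x (r / 4) \<subseteq> ball z0 r" using nearC[OF x] r by (auto simp: C_def)
      have Gx: "G holomorphic_on ball x (r / 4)" using hol[OF G] subr by (rule holomorphic_on_subset)
      have nz: "G y \<noteq> 0" if "y \<in> ball x (r / 4)" for y using big[of y] nearC[OF x] that T(1) by auto
      have xin: "x \<in> ball x (r / 4)" "x \<in> ball x (r / 4 / 2 ^ k)" using r by auto
      have "norm (riccati_cofactor k ?u x - 1) \<le> B * (1 / T)"
      proof (rule bound[OF _ _ _ xin(2)])
        show "?u holomorphic_on ball x (r / 4)" using Gx nz by (intro holomorphic_intros)
        show "\<forall>y\<in>ball x (r / 4). norm (?u y) \<le> 1 / T"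
        proof
          fix y assume "y \<in> ball x (r / 4)"
          then have "T < norm (G y)" using big nearC[OF x] by auto
          then show "norm (?u y) \<le> 1 / T"
              using T(1) by (simp add: norm_inverse norm_divide inverse_eq_divide frac_le)
        qed
      qed (use T in auto)
      then have "norm (1 - riccati_cofactor k ?u x) \<le> 1 / 2"
        using T(2) unfolding norm_minus_commute[of 1] by linarith
      then have q: "1 / 2 \<le> norm (riccati_cofactor k ?u x)"
        using norm_triangle_ineq2[of 1 "1 - riccati_cofactor k ?u x"] by simp
      have eq: "riccati_poly k G x = G x ^ k * riccati_cofactor k ?u x"
        by (rule riccati_poly_eq_cofactor[OF open_ball Gx nz xin(1)])
      have xC: "x \<in> C" using x sC by auto
      have "T \<le> T ^ k" using power_increasing[of 1 k T] T(1) k by simp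
      also have "\<dots> \<le> norm (G x) ^ k" using big[OF xC] T(1) by (intro power_mono) auto
      finally have "d * (T * (1 / 2)) \<le> norm (\<delta> x) * (norm (G x) ^ k * norm (riccati_cofactor k ?u x))"
        using d(1) d(2)[OF x] q T(1) by (intro mult_mono) auto
      also have "\<dots> = norm (\<delta> x * riccati_poly k G x)" by (simp add: eq norm_mult norm_power)
      finally have "3 \<le> norm (\<delta> x * riccati_poly k G x)" using T(3) by simp
      then have "2 \<le> norm (\<delta> x * riccati_poly k G x - 1)"
        using norm_triangle_ineq2[of "\<delta> x * riccati_poly k G x" 1] by simp
      then have "1 / norm (\<delta> x * riccati_poly k G x - 1) \<le> 1 / 2" by (intro frac_le) auto
      then show ?thesis unfolding \<Phi>_def norm_divide norm_one .
    qed
    have h\<Phi>: "\<Phi> holomorphic_on ball z0 r" unfolding \<Phi>_def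
      using omit[OF G] by (intro holomorphic_intros \<delta> riccati_poly_holomorphic hol[OF G]) auto
    have "norm (\<Phi> z0) \<le> 1 / 2" by (rule max_mod[OF h\<Phi> \<Phi>s]) (use r in simp_all)
    then show False by (simp add: \<Phi>_def \<delta>(2))
  qed
  \<comment> \<open>Near a pole one bound serves the whole family: control on \<open>C\<close>
    bounds G on the circle, and the maximum principle carries the bound inside.\<close>
  have bounded: "norm (G x) \<le> K" if G: "G \<in> \<G>" and x: "x \<in> ball z0 (r / 2)" for G x
  proof -
    obtain w where w: "w \<in> C" "norm (G w) \<le> T" using small_somewhere[OF G] by blast
    show ?thesis by (rule max_mod[OF hol[OF G] K[OF G w] x]) (use sC in blast)
  qed
  have "controls \<G> (ball z0 (r / 2)) (ball z0 (r / 2))"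
    by (rule controlsI) (use bounded in blast)
  then show ?thesis unfolding locally_controlled_at_def using r
    by (intro exI[of _ "ball z0 (r / 2)"]) auto
qed

subsection \<open>Normality\<close>

lemma arccos_less_near_one:
  assumes "0 < \<epsilon>"
  obtains \<eta> where "0 < \<eta>" "\<And>x. 1 - \<eta> \<le> x \<Longrightarrow> x \<le> 1 \<Longrightarrow> arccos x < \<epsilon>"
proof -
  \<comment> \<open>The cap at pi is needed because \<open>arccos\<close> inverts \<open>cos\<close>
    only on [0, pi].\<close>
  define e where "e = min \<epsilon> pi"
  have e: "0 < e" "e \<le> pi" "e \<le> \<epsilon>" using assms pi_gt_zero by (auto simp: e_def)
  have "cos e < cos 0" using e by (intro cos_monotone_0_pi) auto
  then have c: "cos e < 1" by simp
  show ?thesis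
  proof (rule that[of "(1 - cos e) / 2"])
    fix x :: real assume x: "1 - (1 - cos e) / 2 \<le> x" "x \<le> 1"
    have "cos e < x" using x c by (simp add: field_simps)
    then have "arccos x < arccos (cos e)" using x cos_ge_minus_one[of e] by (intro arccos_less_arccos) auto
    also have "arccos (cos e) = e" using e by (intro arccos_cos) auto
    finally show "arccos x < \<epsilon>" using e by simp
  qed (use c in auto)
qed

text \<open>The subtracted term is half the squared chordal distance of the two points on the
  sphere.\<close>

lemma inner_stereographic_Some:
  "stereographic (Some a) \<bullet> stereographic (Some b)
     = 1 - 2 * (norm (a - b))\<^sup>2 / ((1 + (norm a)\<^sup>2) * (1 + (norm b)\<^sup>2))"
proof -
  define A where "A = 1 + (norm a)\<^sup>2"
  define B where "B = 1 + (norm b)\<^sup>2"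
  have pos: "0 < A" "0 < B" by (auto simp: A_def B_def intro: add_pos_nonneg)
  have "(2 * a / of_real A) \<bullet> (2 * b / of_real B) = 4 * (a \<bullet> b) / (A * B)"
    by (simp add: inner_complex_def add_divide_distrib mult.assoc)
  then have "stereographic (Some a) \<bullet> stereographic (Some b) = (4 * (a \<bullet> b)
      + ((norm a)\<^sup>2 - 1) * ((norm b)\<^sup>2 - 1)) / (A * B)"
    by (simp add: A_def B_def add_divide_distrib)
  also have "4 * (a \<bullet> b) + ((norm a)\<^sup>2 - 1) * ((norm b)\<^sup>2 - 1) = A * B - 2 * (norm (a - b))\<^sup>2"
    unfolding A_def B_def cmod_power2 inner_complex_def by (simp add: power2_eq_square algebra_simps)
  also have "(A * B - 2 * (norm (a - b))\<^sup>2) / (A * B) = 1 - 2 * (norm (a - b))\<^sup>2 / (A * B)"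
    using pos by (simp add: diff_divide_distrib)
  finally show ?thesis by (simp only: A_def B_def)
qed

lemma spherical_dist_Some_small:
  assumes "0 < \<epsilon>"
  obtains \<delta> where "0 < \<delta>" "\<And>a b. norm (a - b) < \<delta> \<Longrightarrow> spherical_dist (Some a) (Some b) < \<epsilon>"
proof -
  obtain \<eta> where \<eta>: "0 < \<eta>" "\<And>x. 1 - \<eta> \<le> x \<Longrightarrow> x \<le> 1 \<Longrightarrow> arccos x < \<epsilon>"
    using arccos_less_near_one[OF assms] by blast
  show ?thesis
  \<comment> \<open>This makes 2 |a - b|^2 at most \<eta>; the denominator is at least 1, so the
    choice is uniform in a and b.\<close>
  proof (rule that[of "sqrt (\<eta> / 2)"])
    fix a b :: complex assume ab: "norm (a - b) < sqrt (\<eta> / 2)"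
    let ?D = "(1 + (norm a)\<^sup>2) * (1 + (norm b)\<^sup>2)"
    have "1 * 1 \<le> ?D" by (intro mult_mono) auto
    then have D: "1 \<le> ?D" by simp
    have "(norm (a - b))\<^sup>2 \<le> (sqrt (\<eta> / 2))\<^sup>2" using ab by (intro power_mono) auto
    then have "2 * (norm (a - b))\<^sup>2 \<le> \<eta>" using \<eta> by simp
    moreover have "2 * (norm (a - b))\<^sup>2 / ?D \<le> 2 * (norm (a - b))\<^sup>2 / 1"
      using D by (intro divide_left_mono) auto
    moreover have "0 \<le> 2 * (norm (a - b))\<^sup>2 / ?D" using D by simp
    ultimately show "spherical_dist (Some a) (Some b) < \<epsilon>"
      unfolding spherical_dist_def inner_stereographic_Some by (intro \<eta>(2)) linarith+
  qed (use \<eta> in auto)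
qed

lemma spherical_dist_None_small:
  assumes "0 < \<epsilon>"
  obtains T where "\<And>a. T < norm a \<Longrightarrow> spherical_dist (Some a) None < \<epsilon>"
proof -
  obtain \<eta> where \<eta>: "0 < \<eta>" "\<And>x. 1 - \<eta> \<le> x \<Longrightarrow> x \<le> 1 \<Longrightarrow> arccos x < \<epsilon>"
    using arccos_less_near_one[OF assms] by blast
  show ?thesis
  proof (rule that[of "sqrt (2 / \<eta>)"])
    fix a :: complex assume a: "sqrt (2 / \<eta>) < norm a"
    have "(sqrt (2 / \<eta>))\<^sup>2 \<le> (norm a)\<^sup>2" using a \<eta>(1) by (intro power_mono) auto
    then have "2 / \<eta> \<le> 1 + (norm a)\<^sup>2" using \<eta>(1) by simp
    then have le: "2 / (1 + (norm a)\<^sup>2) \<le> \<eta>" using \<eta>(1) by (simp add: field_simps add_pos_nonneg)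
    have "0 < 1 + (norm a)\<^sup>2" by (intro add_pos_nonneg) auto
    then have eq: "stereographic (Some a) \<bullet> stereographic None = 1 - 2 / (1 + (norm a)\<^sup>2)"
      by (simp add: field_simps)
    have "0 \<le> 2 / (1 + (norm a)\<^sup>2)" by (simp add: add_nonneg_nonneg)
    then show "spherical_dist (Some a) None < \<epsilon>"
      unfolding spherical_dist_def eq using le by (intro \<eta>(2)) linarith+
  qed
qed

lemma sphere_val_holomorphic:
  assumes "g holomorphic_on S" "open S" "z \<in> S"
  shows "sphere_val g z = Some (g z)"
proof -
  have "g analytic_on {z}" using assms analytic_at by blast
  then show ?thesis by (simp add: sphere_val_def analytic_at_imp_no_pole)
qed

text \<open>A single base point p decides. If |g n p| tends to infinity, control makes the sequence
  diverge locally uniformly; otherwise a subsequence is bounded at p, hence on compact sets, and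
  Montel's theorem applies.\<close>

lemma locally_controlled_imp_normal:
  assumes D: "open D" "connected D" "p \<in> D"
    and hol: "\<And>g. g \<in> \<G> \<Longrightarrow> g holomorphic_on D"
    and loc: "\<And>z. z \<in> D \<Longrightarrow> locally_controlled_at \<G> z"
  shows "normal_family_on D \<G>"
  unfolding normal_family_on_def
proof (intro conjI ballI allI impI)
  fix g assume "g \<in> \<G>"
  then show "g meromorphic_on D"
    using hol D(1) by (intro analytic_on_imp_meromorphic_on) (simp add: analytic_on_open)
next
  fix g :: "nat \<Rightarrow> complex \<Rightarrow> complex" assume range: "range g \<subseteq> \<G>"
  have gG: "g n \<in> \<G>" for n using range by auto
  have sv: "sphere_val (g n) w = Some (g n w)" if "w \<in> D" for n w
    by (rule sphere_val_holomorphic[OF hol[OF gG] D(1) that])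
  have ctrl: "controls \<G> K K" if "compact K" "K \<subseteq> D" for K
    using D(2) loc that by (rule controls_compact)
  show "\<exists>r L. strict_mono r \<and> ((\<exists>l. l meromorphic_on D \<and> L = sphere_val l) \<or> L = (\<lambda>z. None)) \<and>
    spherically_locally_uniform_limit D (\<lambda>n. sphere_val (g (r n))) L"
  proof (cases "filterlim (\<lambda>n. norm (g n p)) at_top sequentially")
    case True
    have "spherically_locally_uniform_limit D (\<lambda>n. sphere_val (g n)) (\<lambda>z. None)"
      unfolding spherically_locally_uniform_limit_def
    proof
      fix z assume z: "z \<in> D"
      obtain e where e: "0 < e" "cball z e \<subseteq> D" using D(1) z open_contains_cball_eq by blast
      show "\<exists>U. open U \<and> z \<in> U \<and> (\<forall>\<epsilon>>0. \<forall>\<^sub>F n in sequentially. \<forall>w\<in>U \<inter> D. spherical_dist (sphere_val (g n) w) None < \<epsilon>)"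
      proof (intro exI[of _ "ball z e"] conjI allI impI)
        fix \<epsilon> :: real assume "0 < \<epsilon>"
        then obtain T where T: "\<And>a. T < norm a \<Longrightarrow> spherical_dist (Some a) None < \<epsilon>"
          using spherical_dist_None_small by blast
        \<comment> \<open>With p added to the disc, a value of modulus at most T at some w would
          bound |g n p| by K, which eventually fails.\<close>
        have "controls \<G> (insert p (cball z e)) (insert p (cball z e))"
          using e D(3) by (intro ctrl compact_insert) auto
        then obtain K where K: "\<And>h w x. h \<in> \<G> \<Longrightarrow> w \<in> insert p (cball z e) \<Longrightarrow> norm (h w) \<le> T \<Longrightarrow>
            x \<in> insert p (cball z e) \<Longrightarrow> norm (h x) \<le> K"
          using controlsE[of \<G> _ _ T] by metis
        have "\<forall>\<^sub>F n in sequentially. K < norm (g n p)"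
          using True by (simp add: filterlim_at_top_dense)
        then show "\<forall>\<^sub>F n in sequentially. \<forall>w\<in>ball z e \<inter> D. spherical_dist (sphere_val (g n) w) None < \<epsilon>"
        proof eventually_elim
          case (elim n)
          show ?case
          proof
            fix w assume w: "w \<in> ball z e \<inter> D"
            have "T < norm (g n w)"
              using K[OF gG[of n], of w p] w elim by (auto simp: not_le[symmetric])
            then show "spherical_dist (sphere_val (g n) w) None < \<epsilon>" using T sv w by auto
          qed
        qed
      qed (use e in auto)
    qed
    then show ?thesis by (intro exI[of _ id] exI[of _ "\<lambda>z. None"]) (auto simp: strict_mono_def)
  next
    case False
    then obtain T where "\<not> (\<forall>\<^sub>F n in sequentially. T \<le> norm (g n p))" by (auto simp: filterlim_at_top)
    then have "\<exists>\<^sub>F n in sequentially. norm (g n p) \<le> T"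
      unfolding frequently_def by (metis (mono_tags, lifting) eventually_mono linear)
    then have "infinite {n. norm (g n p) \<le> T}" by (simp add: frequently_cofinite flip: cofinite_eq_sequentially)
    then obtain s :: "nat \<Rightarrow> nat" where s: "strict_mono s" "\<And>n. norm (g (s n) p) \<le> T"
      using infinite_enumerate[of "{n. norm (g n p) \<le> T}"] by auto
    define \<H> where "\<H> = {h \<in> \<G>. norm (h p) \<le> T}"
    obtain l r where l: "l holomorphic_on D" and r: "strict_mono (r :: nat \<Rightarrow> nat)"
      and lim: "\<And>K. compact K \<Longrightarrow> K \<subseteq> D \<Longrightarrow> uniform_limit K ((\<lambda>n. g (s n)) \<circ> r) l sequentially"
    proof (rule Montel[of D \<H> "\<lambda>n. g (s n)"])
      show "\<exists>B. \<forall>h\<in>\<H>. \<forall>z\<in>K. norm (h z) \<le> B" if K: "compact K" "K \<subseteq> D" for K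
      proof -
        have "controls \<G> (insert p K) (insert p K)" using K D(3) by (intro ctrl compact_insert) auto
        then obtain B where "\<And>h w x. h \<in> \<G> \<Longrightarrow> w \<in> insert p K \<Longrightarrow> norm (h w) \<le> T \<Longrightarrow> x \<in> insert p K \<Longrightarrow> norm (h x) \<le> B"
          using controlsE[of \<G> _ _ T] by metis
        then show ?thesis unfolding \<H>_def by blast
      qed
    qed (use D hol gG s in \<open>auto simp: \<H>_def\<close>)
    have svl: "sphere_val l w = Some (l w)" if "w \<in> D" for w
      by (rule sphere_val_holomorphic[OF l D(1) that])
    have "spherically_locally_uniform_limit D (\<lambda>n. sphere_val (g ((s \<circ> r) n))) (sphere_val l)"
      unfolding spherically_locally_uniform_limit_def
    proof
      fix z assume z: "z \<in> D"
      obtain e where e: "0 < e" "cball z e \<subseteq> D" using D(1) z open_contains_cball_eq by blast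
      show "\<exists>U. open U \<and> z \<in> U \<and> (\<forall>\<epsilon>>0. \<forall>\<^sub>F n in sequentially. \<forall>w\<in>U \<inter> D. spherical_dist (sphere_val (g ((s \<circ> r) n)) w) (sphere_val l w) < \<epsilon>)"
      proof (intro exI[of _ "ball z e"] conjI allI impI)
        fix \<epsilon> :: real assume "0 < \<epsilon>"
        then obtain \<delta> where \<delta>: "0 < \<delta>" "\<And>a b. norm (a - b) < \<delta> \<Longrightarrow> spherical_dist (Some a) (Some b) < \<epsilon>"
          using spherical_dist_Some_small by metis
        have "\<forall>\<^sub>F n in sequentially. \<forall>x\<in>cball z e. dist (((\<lambda>n. g (s n)) \<circ> r) n x) (l x) < \<delta>"
          using uniform_limitD[OF lim[OF compact_cball e(2)] \<delta>(1)] .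
        then show "\<forall>\<^sub>F n in sequentially. \<forall>w\<in>ball z e \<inter> D. spherical_dist (sphere_val (g ((s \<circ> r) n)) w) (sphere_val l w) < \<epsilon>"
          by eventually_elim (auto simp: sv svl dist_norm intro!: \<delta>(2))
      qed (use e in auto)
    qed
    moreover have "l meromorphic_on D"
      using l D(1) by (intro analytic_on_imp_meromorphic_on) (simp add: analytic_on_open)
    ultimately show ?thesis using strict_mono_o[OF s(1) r] by blast
  qed
qed

section \<open>Schwarzian derivatives and the conclusion\<close>

lemma controls_scale:
  assumes "controls \<G> A B" and c: "c \<noteq> 0"
  shows "controls ((\<lambda>g z. c * g z) ` \<G>) A B"
proof (rule controlsI)
  fix T :: real
  obtain K where K: "\<And>g w x. g \<in> \<G> \<Longrightarrow> w \<in> A \<Longrightarrow> norm (g w) \<le> T / norm c \<Longrightarrow> x \<in> B \<Longrightarrow> norm (g x) \<le> K"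
    using controlsE[OF assms(1), of "T / norm c"] by metis
  have "norm (c * g x) \<le> norm c * K" if "g \<in> \<G>" "w \<in> A" "norm (c * g w) \<le> T" "x \<in> B" for g w x
    unfolding norm_mult using that c by (intro mult_left_mono K[of g w]) (auto simp: norm_mult field_simps)
  then show "\<exists>K. \<forall>g w x. g \<in> (\<lambda>g z. c * g z) ` \<G> \<longrightarrow> w \<in> A \<longrightarrow> norm (g w) \<le> T \<longrightarrow> x \<in> B \<longrightarrow> norm (g x) \<le> K"
    by blast
qed

lemma locally_univalent_deriv_nonzero:
  assumes f: "f holomorphic_on D" and D: "open D" and univ: "locally_univalent_on f D" and z: "z \<in> D"
  shows "deriv f z \<noteq> 0"
proof -
  obtain U where U: "open U" "z \<in> U" "inj_on f (U \<inter> D)"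
    using univ z unfolding locally_univalent_on_def by blast
  show ?thesis
    by (rule holomorphic_injective_imp_regular[of f "U \<inter> D"])
      (use U z D f in \<open>auto intro: holomorphic_on_subset\<close>)
qed

text \<open>With \<open>h = (f')\<^bsup>-1/k\<^esup>\<close> one has \<open>h'/h = - f''/(k f')\<close> and \<open>S_k(f) = - k h\<^bsup>(k)\<^esup>/h\<close>.\<close>

lemma gen_schwarzian_eq_riccati_poly:
  assumes D: "open D" and g: "pre_schwarzian f holomorphic_on D" and k: "0 < k" and z: "z \<in> D"
  shows "gen_schwarzian k f z = - of_nat k * riccati_poly k (\<lambda>z. - pre_schwarzian f z / of_nat k) z"
proof -
  define G where "G = (\<lambda>z. - pre_schwarzian f z / of_nat k)"
  have G: "G holomorphic_on D" unfolding G_def using g k by (intro holomorphic_intros) auto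
  \<comment> \<open>The factor \<open>- 1 / of_nat k * pre_schwarzian f z\<close> of the recursion
    is therefore G itself; this is where the second index of the iterate has to be k.\<close>
  have gG: "pre_schwarzian f z = - of_nat k * G z" for z using k by (simp add: G_def)
  have "schwarzian_iter (Suc (Suc j)) k f z = - of_nat k * riccati_poly (Suc j) G z" if "z \<in> D" for j z
    using that
  proof (induction j arbitrary: z)
    case 0
    show ?case using gG[of z] by simp
  next
    case (Suc j)
    let ?P = "riccati_poly (Suc j) G"
    have "(?P has_field_derivative deriv ?P z) (at z)"
      by (rule holomorphic_derivI[OF riccati_poly_holomorphic[OF D G] D Suc.prems])
    then have "deriv (\<lambda>z. - of_nat k * ?P z) z = - of_nat k * deriv ?P z"
      by (intro DERIV_imp_deriv DERIV_cmult)
    moreover have "deriv (schwarzian_iter (Suc (Suc j)) k f) z = deriv (\<lambda>z. - of_nat k * ?P z) z"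
      by (rule deriv_eq_on_open[OF D Suc.prems Suc.IH])
    ultimately have "deriv (schwarzian_iter (Suc (Suc j)) k f) z = - of_nat k * deriv ?P z" by simp
    then show ?case
      unfolding schwarzian_iter.simps(4) riccati_poly.simps(2)[of "Suc j"] Suc.IH[OF Suc.prems] gG[of z]
      using k by (simp add: algebra_simps del: schwarzian_iter.simps riccati_poly.simps)
  qed
  \<comment> \<open>With j = k - 1 the first index j + 2 is the k + 1 of
    \<open>gen_schwarzian\<close>.\<close>
  from this[OF z, of "k - 1"] show ?thesis using k by (simp add: gen_schwarzian_def G_def)
qed

theorem theorem1p4:
  fixes \<F> :: "(complex \<Rightarrow> complex) set" and k :: nat and b :: "complex \<Rightarrow> complex"
  assumes hol: "\<And>f. f \<in> \<F> \<Longrightarrow> f holomorphic_on ball 0 1"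
    and univ: "\<And>f. f \<in> \<F> \<Longrightarrow> locally_univalent_on f (ball 0 1)"
    and k: "k \<ge> 2"
    and b: "b meromorphic_on ball 0 1"
    and omit: "\<And>f z. f \<in> \<F> \<Longrightarrow> z \<in> ball 0 1 \<Longrightarrow>
                 sphere_val (gen_schwarzian k f) z \<noteq> sphere_val b z"
  shows "normal_family_on (ball 0 1) {pre_schwarzian f | f. f \<in> \<F>}"
proof -
  let ?D = "ball 0 1 :: complex set"
  have pre: "pre_schwarzian f holomorphic_on ?D" if f: "f \<in> \<F>" for f
    unfolding pre_schwarzian_def[abs_def]
    using locally_univalent_deriv_nonzero[OF hol[OF f] open_ball univ[OF f]]
    by (intro holomorphic_intros holomorphic_deriv hol f) auto
  define G where "G f z = - pre_schwarzian f z / of_nat k" for f z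
  define \<G> where "\<G> = G ` \<F>"
  have G: "g holomorphic_on ?D" if "g \<in> \<G>" for g
    using that pre k unfolding \<G>_def G_def[abs_def] by (auto intro!: holomorphic_intros)
  have omitG: "Some (- of_nat k * riccati_poly k g z) \<noteq> sphere_val b z" if g: "g \<in> \<G>" and z: "z \<in> ?D" for g z
  proof -
    obtain f where f: "f \<in> \<F>" "g = G f" using g by (auto simp: \<G>_def)
    have eq: "gen_schwarzian k f w = - of_nat k * riccati_poly k g w" if "w \<in> ?D" for w
      unfolding f(2) G_def[abs_def]
      using gen_schwarzian_eq_riccati_poly[OF open_ball pre[OF f(1)] _ that] k by simp
    have "(\<lambda>w. - of_nat k * riccati_poly k g w) holomorphic_on ?D"
      by (intro holomorphic_intros riccati_poly_holomorphic G g) auto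
    then have "gen_schwarzian k f holomorphic_on ?D"
      using eq by (subst holomorphic_cong[OF refl, of _ _ "\<lambda>w. - of_nat k * riccati_poly k g w"]) auto
    then have "sphere_val (gen_schwarzian k f) z = Some (gen_schwarzian k f z)"
      by (rule sphere_val_holomorphic[OF _ open_ball z])
    then show ?thesis using omit[OF f(1) z] eq[OF z] by simp
  qed
  have loc: "locally_controlled_at \<G> z0" if z0: "z0 \<in> ?D" for z0
  proof -
    have mero: "b meromorphic_on {z0}" by (rule meromorphic_on_subset[OF b]) (use z0 in simp)
    obtain r0 where r0: "0 < r0" "b analytic_on ball z0 r0 - {z0}"
      using meromorphic_on_isolated_singularity[OF mero] unfolding isolated_singularity_at_def by blast
    obtain r1 where r1: "0 < r1" "ball z0 r1 \<subseteq> ?D" using z0 openE[OF open_ball] by metis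
    have ana: "b analytic_on {w}" if "w \<in> ball z0 r0 - {z0}" for w
      by (rule analytic_on_subset[OF r0(2)]) (use that in simp)
    show ?thesis
    proof (cases "is_pole b z0")
      case False
      then obtain c where c: "b \<midarrow>z0\<rightarrow> c"
        using meromorphic_on_not_essential[OF mero] unfolding not_essential_def by blast
      have "remove_sings b analytic_on {z0}"
        using meromorphic_on_isolated_singularity[OF mero] c by (rule remove_sings_analytic_at)
      then obtain r2 where r2: "0 < r2" "remove_sings b holomorphic_on ball z0 r2"
        by (auto simp: analytic_on_def)
      define r where "r = min r0 (min r1 r2)"
      have r: "0 < r" "r \<le> r0" "r \<le> r1" "r \<le> r2" using r0 r1 r2 by (auto simp: r_def)
      have sub: "ball z0 r \<subseteq> ?D" using r r1 by auto
      \<comment> \<open>The value of \<open>b\<close> at z0 is arbitrary; \<open>sphere_val\<close>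
        takes the limit there, which is the value of the holomorphic function
        \<open>remove_sings b\<close>.\<close>
      have sv: "sphere_val b z = Some (remove_sings b z)" if "z \<in> ball z0 r" for z
      proof (cases "z = z0")
        case True
        then show ?thesis using False by (simp add: sphere_val_def)
      next
        case False
        then have "b analytic_on {z}" using that r by (intro ana) auto
        then show ?thesis by (simp add: sphere_val_def analytic_at_imp_no_pole)
      qed
      show ?thesis
      proof (rule omitted_holomorphic_locally_controlled[of \<G> "ball z0 r" z0 k "\<lambda>z. - remove_sings b z / of_nat k"])
        show "g holomorphic_on ball z0 r" if "g \<in> \<G>" for g using G[OF that] sub by (rule holomorphic_on_subset)
        show "(\<lambda>z. - remove_sings b z / of_nat k) holomorphic_on ball z0 r"
          using r k by (intro holomorphic_intros holomorphic_on_subset[OF r2(2)]) auto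
        show "riccati_poly k g z \<noteq> - remove_sings b z / of_nat k" if "g \<in> \<G>" "z \<in> ball z0 r" for g z
          using omitG[OF that(1), of z] sv[OF that(2)] sub that(2) k by (auto simp: field_simps)
      qed (use r k in auto)
    next
      case True
      obtain r2 where r2: "0 < r2" "\<And>z. z \<in> ball z0 r2 - {z0} \<Longrightarrow> b z \<noteq> 0"
        using non_zero_neighbour_pole[OF True] unfolding eventually_at by (auto simp: dist_commute)
      define r where "r = min r0 (min r1 r2)"
      have r: "0 < r" "r \<le> r0" "r \<le> r1" "r \<le> r2" using r0 r1 r2 by (auto simp: r_def)
      have sub: "ball z0 r \<subseteq> ?D" using r r1 by auto
      have bnz: "b z \<noteq> 0" if "z \<in> ball z0 r - {z0}" for z using r2(2) that r by auto
      \<comment> \<open>\<delta> is - k / b with the pole filled in by 0, so that - k * riccati_poly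
        k g \<noteq> b becomes \<delta> * riccati_poly k g \<noteq> 1, a condition between
        holomorphic functions.\<close>
      define \<delta> where "\<delta> = (\<lambda>z. - of_nat k * (if z = z0 then 0 else inverse (b z)))"
      show ?thesis
      proof (rule omitted_pole_locally_controlled[of \<G> z0 r k \<delta>])
        show "g holomorphic_on ball z0 r" if "g \<in> \<G>" for g using G[OF that] sub by (rule holomorphic_on_subset)
        have "b analytic_on ball z0 r - {z0}" using r0(2) r by (auto intro: analytic_on_subset)
        then have "b holomorphic_on ball z0 r - {z0}" by (rule analytic_imp_holomorphic)
        then have "(\<lambda>z. if z = z0 then 0 else inverse (b z)) holomorphic_on ball z0 r"
          using True bnz by (intro is_pole_inverse_holomorphic) auto
        then show "\<delta> holomorphic_on ball z0 r" unfolding \<delta>_def by (intro holomorphic_intros)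
        show "\<delta> z \<noteq> 0" if "z \<in> ball z0 r - {z0}" for z using bnz[OF that] that k by (auto simp: \<delta>_def)
        show "\<delta> z * riccati_poly k g z \<noteq> 1" if g: "g \<in> \<G>" and z: "z \<in> ball z0 r" for g z
        proof (cases "z = z0")
          case False
          then have "b analytic_on {z}" using z r by (intro ana) auto
          then have "sphere_val b z = Some (b z)" by (simp add: sphere_val_def analytic_at_imp_no_pole)
          then have "- of_nat k * riccati_poly k g z \<noteq> b z" using omitG[OF g, of z] sub z by auto
          then show ?thesis using bnz[of z] False z by (auto simp: \<delta>_def field_simps)
        qed (simp add: \<delta>_def)
      qed (use r k in \<open>auto simp: \<delta>_def\<close>)
    qed
  qed
  have eq: "{pre_schwarzian f | f. f \<in> \<F>} = (\<lambda>g z. - of_nat k * g z) ` \<G>"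
    using k by (force simp: \<G>_def G_def image_image)
  show ?thesis
  proof (rule locally_controlled_imp_normal[of _ 0])
    fix z assume "z \<in> ?D"
    then obtain U where U: "open U" "z \<in> U" "controls \<G> U U"
      using loc unfolding locally_controlled_at_def by blast
    have "controls ((\<lambda>g z. - of_nat k * g z) ` \<G>) U U"
      using U(3) by (rule controls_scale) (use k in simp)
    then show "locally_controlled_at {pre_schwarzian f | f. f \<in> \<F>} z"
      unfolding eq locally_controlled_at_def using U by blast
  qed (use pre in auto)
qed

end
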